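(* For each positive integer $k$, the round complexity of the $\mathsf{LCL}$ problem $\Pi_k$ (defined in the context) on $n$-node full binary rooted trees is $\Theta(n^{1/k})$ in both the $\mathsf{LOCAL}$ and the $\mathsf{CONGEST}$ model.
   Context: An $\mathsf{LCL}$ problem is a triple $\Pi=(\delta,\Sigma,\mathcal C)$ where $\delta\ge 1$ is an integer, $\Sigma$ is a finite set of labels, and $\mathcal C\subseteq\Sigma^{\delta+1}$ is a set of allowed configurations, written $(a:b_1,\dots,b_\delta)$; the order of $b_1,\dots,b_\delta$ is irrelevant. Inputs are unlabeled full $\delta$-ary rooted trees (every node has exactly $\delta$ or $0$ children). A solution on a tree $T$ is a labeling $\lambda:V(T)\to\Sigma$ such that for every node $v$ with $\delta$ children $v_1,\dots,v_\delta$ there is a permutation $\rho$ of $\{1,\dots,\delta\}$ with $(\lambda(v):\lambda(v_{\rho(1)}),\dots,\lambda(v_{\rho(\delta)}))\in\mathcal C$; nodes whose number of children is not $\delta$ are unconstrained. The problem $\Pi_k=(2,\Sigma_k,\mathcal C_k)$: $\Sigma_k=\{a_1,b_1,x_1,a_2,b_2,x_2,\dots,x_{k-1},a_k,b_k\}$, and $\mathcal C_k$ consists of exactly the following configurations: (i) for $1\le i\le k$: $(a_i:\sigma,\sigma')$ for all $\sigma,\sigma'\in\{a_1,b_1,x_1,\dots,a_{i-1},b_{i-1},x_{i-1}\}\cup\{b_i\}$; (ii) for $1\le i\le k$: $(b_i:\sigma,\sigma')$ for all $\sigma,\sigma'\in\{a_1,b_1,x_1,\dots,a_{i-1},b_{i-1},x_{i-1}\}\cup\{a_i\}$;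 (iii) for $1\le i\le k-1$: $(x_i:\sigma,\sigma')$ for all $\sigma\in\Sigma_k$ and all $\sigma'\in\{a_1,b_1,x_1,\dots,a_{i-1},b_{i-1},x_{i-1}\}\cup\{a_i,b_i\}$. Models. In $\mathsf{LOCAL}$ on an $n$-node graph each node has a unique identifier from $\{1,\dots,\mathrm{poly}(n)\}$ and initially knows its identifier, its degree, $n$, the maximum degree, and which incident edge leads to its parent. In synchronous rounds nodes exchange unbounded messages with neighbors and do unbounded local computation; each node eventually outputs its label. The running time is the number of rounds until all nodes have output. $\mathsf{CONGEST}$ is the same with $O(\log n)$-bit messages. The round complexity is the best worst-case running time, as a function of $n$, of an algorithm solving the problem. *)

theory Defs
  imports Complex_Main "HOL-Library.Extended_Nat" "HOL-Library.Landau_Symbols"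
begin

section \<open>Rooted trees\<close>

record rooted_tree =
  verts :: "nat set"
  root_node :: nat
  parent :: "nat \<Rightarrow> nat option"

definition children :: "('z) rooted_tree_scheme \<Rightarrow> nat \<Rightarrow> nat set" where
  "children T v = {w \<in> verts T. parent T w = Some v}"

definition neighbours :: "('z) rooted_tree_scheme \<Rightarrow> nat \<Rightarrow> nat set" where
  "neighbours T v = children T v \<union> set_option (parent T v)"

definition is_rooted_tree :: "('z) rooted_tree_scheme \<Rightarrow> bool" where
  "is_rooted_tree T \<longleftrightarrow>
     finite (verts T) \<and> root_node T \<in> verts T \<and> parent T (root_node T) = None \<and>
     (\<forall>v \<in> verts T - {root_node T}. \<exists>u \<in> verts T. parent T v = Some u) \<and>
     (\<forall>v \<in> verts T. (v, root_node T) \<in> {(w, u). w \<in> verts T \<and> parent T w = Some u}\<^sup>*)"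

definition is_full_tree :: "nat \<Rightarrow> ('z) rooted_tree_scheme \<Rightarrow> bool" where
  "is_full_tree \<delta> T \<longleftrightarrow>
     is_rooted_tree T \<and> (\<forall>v \<in> verts T. card (children T v) = 0 \<or> card (children T v) = \<delta>)"


section \<open>LCL problems\<close>

text \<open>The pair \<open>(a, [b\<^sub>1, \<dots>, b\<^sub>\<delta>])\<close> stands for the configuration
  \<open>(a : b\<^sub>1, \<dots>, b\<^sub>\<delta>)\<close>.\<close>

record 'l lcl =
  arity :: nat
  labels :: "'l set"
  configs :: "('l \<times> 'l list) set"

definition is_lcl :: "'l lcl \<Rightarrow> bool" where
  "is_lcl \<Pi> \<longleftrightarrow> arity \<Pi> \<ge> 1 \<and> finite (labels \<Pi>) \<and>
     configs \<Pi> \<subseteq> labels \<Pi> \<times> {bs. set bs \<subseteq> labels \<Pi> \<and> length bs = arity \<Pi>}"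

text \<open>The order of the \<open>b\<^sub>i\<close> is irrelevant: some enumeration \<open>ws\<close> of the children has to match an
  allowed configuration.\<close>

definition is_solution :: "'l lcl \<Rightarrow> ('z) rooted_tree_scheme \<Rightarrow> (nat \<Rightarrow> 'l) \<Rightarrow> bool" where
  "is_solution \<Pi> T lab \<longleftrightarrow>
     (\<forall>v \<in> verts T. lab v \<in> labels \<Pi>) \<and>
     (\<forall>v \<in> verts T. card (children T v) = arity \<Pi> \<longrightarrow>
        (\<exists>ws. distinct ws \<and> set ws = children T v \<and> (lab v, map lab ws) \<in> configs \<Pi>))"


section \<open>The problems \<open>\<Pi>\<^sub>k\<close>\<close>

datatype label = LabA nat | LabB nat | LabX nat

definition below :: "nat \<Rightarrow> label set" where
  "below i = (\<Union>j \<in> {1..<i}. {LabA j, LabB j, LabX j})"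

definition Sigma_k :: "nat \<Rightarrow> label set" where
  "Sigma_k k = below k \<union> {LabA k, LabB k}"

definition Pi_k :: "nat \<Rightarrow> label lcl" where
  "Pi_k k = \<lparr>arity = 2, labels = Sigma_k k, configs =
       {(LabA i, [s, s']) | i s s'. 1 \<le> i \<and> i \<le> k \<and> s \<in> below i \<union> {LabB i} \<and> s' \<in> below i \<union> {LabB i}}
     \<union> {(LabB i, [s, s']) | i s s'. 1 \<le> i \<and> i \<le> k \<and> s \<in> below i \<union> {LabA i} \<and> s' \<in> below i \<union> {LabA i}}
     \<union> {(LabX i, [s, s']) | i s s'. 1 \<le> i \<and> i < k \<and> s \<in> Sigma_k k \<and> s' \<in> below i \<union> {LabA i, LabB i}}\<rparr>"

lemma is_lcl_Pi_k:
  assumes "k \<ge> 1"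
  shows "is_lcl (Pi_k k)"
proof -
  have below_mono: "below i \<subseteq> below k" if "i \<le> k" for i
    using that by (force simp: below_def)
  have "finite (Sigma_k k)"
    by (simp add: Sigma_k_def below_def)
  moreover have "below i \<union> {LabA i, LabB i} \<subseteq> Sigma_k k" if "1 \<le> i" "i \<le> k" for i
    using that below_mono[of i] by (cases "i = k") (auto simp: Sigma_k_def below_def)
  moreover have "LabX i \<in> Sigma_k k" if "1 \<le> i" "i < k" for i
    using that by (auto simp: Sigma_k_def below_def)
  ultimately show ?thesis
    unfolding is_lcl_def Pi_k_def by (fastforce dest: less_imp_le)
qed


section \<open>Synchronous message passing\<close>

text \<open>A network is a rooted tree with identifiers and an arbitrary port numbering: \<open>ports N v ! i\<close>
  is the neighbour of \<open>v\<close> at the other end of the \<open>i\<close>-th edge incident to \<open>v\<close>. The names of the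
  vertices are never visible to an algorithm.\<close>

record network = rooted_tree +
  ident :: "nat \<Rightarrow> nat"
  ports :: "nat \<Rightarrow> nat list"

text \<open>Identifiers come from \<open>{1, \<dots>, n\<^sup>c}\<close>; the exponent \<open>c\<close> is a parameter of the model.\<close>

definition networks :: "nat \<Rightarrow> nat \<Rightarrow> nat \<Rightarrow> network set" where
  "networks c \<delta> n = {N. is_full_tree \<delta> N \<and> card (verts N) = n \<and>
     inj_on (ident N) (verts N) \<and> ident N ` verts N \<subseteq> {1..n ^ c} \<and>
     (\<forall>v \<in> verts N. distinct (ports N v) \<and> set (ports N v) = neighbours N v)}"

definition port_to :: "network \<Rightarrow> nat \<Rightarrow> nat \<Rightarrow> nat" where
  "port_to N v w = (THE i. i < length (ports N v) \<and> ports N v ! i = w)"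

record knowledge =
  own_id :: nat
  own_degree :: nat
  num_nodes :: nat
  max_degree :: nat
  parent_port :: "nat option"

definition initial_knowledge :: "network \<Rightarrow> nat \<Rightarrow> knowledge" where
  "initial_knowledge N v =
     \<lparr>own_id = ident N v,
      own_degree = length (ports N v),
      num_nodes = card (verts N),
      max_degree = Max ((\<lambda>u. length (ports N u)) ` verts N),
      parent_port = map_option (port_to N v) (parent N v)\<rparr>"

text \<open>A message is a bit string. After \<open>t\<close> rounds a node has seen a list of \<open>t\<close> entries, whose
  \<open>s\<close>-th entry lists, port by port, the messages received in the \<open>s\<close>-th round. Since local
  computation is unrestricted, a deterministic algorithm is given by arbitrary functions of the
  initial knowledge and this history: the message to send through each port in the next round, and
  the output, if any.\<close>

type_synonym message = "bool list"
type_synonym history = "message list list"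

record 'l algorithm =
  send :: "knowledge \<Rightarrow> history \<Rightarrow> nat \<Rightarrow> message"
  decide :: "knowledge \<Rightarrow> history \<Rightarrow> 'l option"

primrec history_of :: "'l algorithm \<Rightarrow> network \<Rightarrow> nat \<Rightarrow> nat \<Rightarrow> history" where
  "history_of A N 0 = (\<lambda>v. [])"
| "history_of A N (Suc t) = (\<lambda>v. history_of A N t v @
     [map (\<lambda>w. send A (initial_knowledge N w) (history_of A N t w) (port_to N w v)) (ports N v)])"

definition decision :: "'l algorithm \<Rightarrow> network \<Rightarrow> nat \<Rightarrow> nat \<Rightarrow> 'l option" where
  "decision A N t v = decide A (initial_knowledge N v) (history_of A N t v)"

text \<open>The first decision of a node is its irrevocable output; afterwards the node may still relay
  messages.\<close>

definition output_label :: "'l algorithm \<Rightarrow> network \<Rightarrow> nat \<Rightarrow> 'l" where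
  "output_label A N v = the (decision A N (LEAST t. decision A N t v \<noteq> None) v)"

definition running_time :: "'l algorithm \<Rightarrow> network \<Rightarrow> enat" where
  "running_time A N = Inf {enat t | t. \<forall>v \<in> verts N. \<exists>s \<le> t. decision A N s v \<noteq> None}"

definition worst_case_time :: "nat \<Rightarrow> 'l lcl \<Rightarrow> 'l algorithm \<Rightarrow> nat \<Rightarrow> enat" where
  "worst_case_time c \<Pi> A n = (SUP N \<in> networks c (arity \<Pi>) n. running_time A N)"

definition solves :: "nat \<Rightarrow> 'l lcl \<Rightarrow> 'l algorithm \<Rightarrow> bool" where
  "solves c \<Pi> A \<longleftrightarrow> (\<forall>n. \<forall>N \<in> networks c (arity \<Pi>) n.
     (\<forall>v \<in> verts N. \<exists>t. decision A N t v \<noteq> None) \<and> is_solution \<Pi> N (output_label A N))"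

text \<open>The \<open>O(log n)\<close> bandwidth of CONGEST is \<open>\<beta> \<lceil>log\<^sub>2 n\<rceil>\<close> bits, with the constant \<open>\<beta>\<close> a
  parameter of the model. (It must not depend on the algorithm when the best algorithm is taken
  separately for each \<open>n\<close> below: otherwise the bandwidth would be unlimited.)\<close>

definition respects_bandwidth :: "nat \<Rightarrow> nat \<Rightarrow> 'l lcl \<Rightarrow> 'l algorithm \<Rightarrow> bool" where
  "respects_bandwidth \<beta> c \<Pi> A \<longleftrightarrow> (\<forall>n. \<forall>N \<in> networks c (arity \<Pi>) n.
     \<forall>t. \<forall>v \<in> verts N. \<forall>i < length (ports N v).
       length (send A (initial_knowledge N v) (history_of A N t v) i) \<le> \<beta> * nat \<lceil>log 2 (real n)\<rceil>)"

text \<open>As every node knows \<open>n\<close>, algorithms that are good for different \<open>n\<close> combine into a single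
  one, so the pointwise infimum is the worst-case running time of one best algorithm.\<close>

definition local_complexity :: "nat \<Rightarrow> 'l lcl \<Rightarrow> nat \<Rightarrow> enat" where
  "local_complexity c \<Pi> n = (INF A \<in> {A. solves c \<Pi> A}. worst_case_time c \<Pi> A n)"

definition congest_complexity :: "nat \<Rightarrow> nat \<Rightarrow> 'l lcl \<Rightarrow> nat \<Rightarrow> enat" where
  "congest_complexity \<beta> c \<Pi> n =
     (INF A \<in> {A. solves c \<Pi> A \<and> respects_bandwidth \<beta> c \<Pi> A}. worst_case_time c \<Pi> A n)"

text \<open>A full binary tree has an odd number of nodes, and every odd number occurs; asymptotics are
  taken along these \<open>n\<close>.\<close>

definition odd_at_top :: "nat filter" where
  "odd_at_top = inf at_top (principal {n. odd n})"

text \<open>A complexity is eventually finite before it is compared as a real function.\<close>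

definition has_order :: "(nat \<Rightarrow> enat) \<Rightarrow> (nat \<Rightarrow> real) \<Rightarrow> nat filter \<Rightarrow> bool" where
  "has_order C f F \<longleftrightarrow> (\<forall>\<^sub>F n in F. C n \<noteq> \<infinity>) \<and> (\<lambda>n. real (the_enat (C n))) \<in> \<Theta>[F](f)"

end

theory Submission
  imports Defs "HOL-Library.Multiset"
begin

text \<open>Upper bound: with \<open>s\<close> about the \<open>k\<close>-th root of \<open>n\<close>, repeat \<open>k\<close> times: for \<open>s\<close> rounds peel off all vertices whose
  children have been peeled (levels \<open>a\<^sub>i\<close>, \<open>b\<^sub>i\<close>), then peel off every vertex with a peeled child (\<open>x\<^sub>i\<close>). The
  survivors of a phase are branching vertices of subtrees of height at least \<open>s\<close>, so each phase divides the
  number of vertices by \<open>s\<close>. The components labelled \<open>a\<^sub>i\<close>, \<open>b\<^sub>i\<close> have height at most \<open>s\<close> and are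
  2-coloured from the top in \<open>s\<close> further rounds. One broadcast bit per round suffices.

  Lower bound: take nested left spines of length \<open>L\<close>, where from every vertex of a spine of rank \<open>i\<close>
  hangs a tree of rank \<open>i - 1\<close>; rank \<open>k\<close> needs about \<open>L\<^sup>k\<close> vertices. By induction the top of a tree of rank
  \<open>i\<close> cannot have a label of level below \<open>i\<close>, nor \<open>a\<^sub>i\<close> or \<open>b\<^sub>i\<close>: otherwise the labels \<open>a\<^sub>i\<close>, \<open>b\<^sub>i\<close>
  alternate along most of the spine, and moving one spine vertex (with what hangs from it) from far below to
  the middle changes the parity of a long distance without changing what the two ends see. For \<open>i = k\<close> no
  label is left.\<close>

section \<open>Networks from binary trees\<close>

datatype itree = Lf nat | Nd nat itree itree

primrec top_node :: "itree \<Rightarrow> nat" where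
  "top_node (Lf a) = a"
| "top_node (Nd a l r) = a"

primrec nodes :: "itree \<Rightarrow> nat set" where
  "nodes (Lf a) = {a}"
| "nodes (Nd a l r) = insert a (nodes l \<union> nodes r)"

primrec distinct_nodes :: "itree \<Rightarrow> bool" where
  "distinct_nodes (Lf a) = True"
| "distinct_nodes (Nd a l r) \<longleftrightarrow> a \<notin> nodes l \<and> a \<notin> nodes r \<and> nodes l \<inter> nodes r = {} \<and>
     distinct_nodes l \<and> distinct_nodes r"

text \<open>A tree is stored as its set of triples (vertex, left child, right child), so that two
  trees can be compared locally by asking which triples they share.\<close>

primrec branchings :: "itree \<Rightarrow> (nat \<times> nat \<times> nat) set" where
  "branchings (Lf a) = {}"
| "branchings (Nd a l r) = insert (a, top_node l, top_node r) (branchings l \<union> branchings r)"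

lemma top_node_in_nodes [simp]: "top_node T \<in> nodes T"
  by (cases T) auto

lemma finite_nodes [simp]: "finite (nodes T)"
  by (induction T) auto

lemma branchings_nodes:
  "(a, b, c) \<in> branchings T \<Longrightarrow> a \<in> nodes T \<and> b \<in> nodes T \<and> c \<in> nodes T"
  by (induction T) auto

lemma branchings_distinct:
  "distinct_nodes T \<Longrightarrow> (a, b, c) \<in> branchings T \<Longrightarrow> b \<noteq> c \<and> b \<noteq> top_node T \<and> c \<noteq> top_node T"
proof (induction T)
  case (Nd x l r)
  then have "top_node l \<notin> nodes r" "top_node r \<notin> nodes l" "\<And>y. y \<in> nodes l \<Longrightarrow> y \<notin> nodes r"
    by (simp_all add: disjoint_iff) (metis top_node_in_nodes)+
  moreover have "top_node l \<noteq> top_node r" using calculation by (metis top_node_in_nodes)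
  ultimately show ?case using Nd by (auto dest: branchings_nodes)
qed auto

lemma branchings_unique_parent:
  "distinct_nodes T \<Longrightarrow> (a, b, c) \<in> branchings T \<Longrightarrow> (a, b', c') \<in> branchings T \<Longrightarrow> b = b' \<and> c = c'"
proof (induction T)
  case (Nd x l r)
  then show ?case by (auto dest: branchings_nodes)
qed auto

section \<open>Parents and children as partial functions on the nodes\<close>

definition child_rel :: "itree \<Rightarrow> (nat \<times> nat) set" where
  "child_rel T = {(w, a). \<exists>b. (a, w, b) \<in> branchings T \<or> (a, b, w) \<in> branchings T}"

lemma child_rel_simps [simp]:
  "child_rel (Lf a) = {}"
  "child_rel (Nd a l r) = insert (top_node l, a) (insert (top_node r, a) (child_rel l \<union> child_rel r))"
  by (auto simp: child_rel_def)

lemma child_rel_nodes: "(w, a) \<in> child_rel T \<Longrightarrow> w \<in> nodes T \<and> a \<in> nodes T"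
  by (auto simp: child_rel_def dest: branchings_nodes)

lemma child_rel_not_top_node: "distinct_nodes T \<Longrightarrow> (w, a) \<in> child_rel T \<Longrightarrow> w \<noteq> top_node T"
  by (auto simp: child_rel_def dest: branchings_distinct)

lemma child_rel_unique:
  "distinct_nodes T \<Longrightarrow> (w, a) \<in> child_rel T \<Longrightarrow> (w, a') \<in> child_rel T \<Longrightarrow> a = a'"
proof (induction T)
  case (Nd x l r)
  then have "top_node l \<notin> nodes r" "top_node r \<notin> nodes l" "\<And>y. y \<in> nodes l \<Longrightarrow> y \<notin> nodes r"
    by (simp_all add: disjoint_iff) (metis top_node_in_nodes)+
  with Nd show ?case by (auto dest: child_rel_nodes child_rel_not_top_node)
qed auto

lemma child_rel_asym: "distinct_nodes T \<Longrightarrow> (w, a) \<in> child_rel T \<Longrightarrow> (a, w) \<notin> child_rel T"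
proof (induction T)
  case (Nd x l r)
  then have "top_node l \<notin> nodes r" "top_node r \<notin> nodes l" "\<And>y. y \<in> nodes l \<Longrightarrow> y \<notin> nodes r"
    by (simp_all add: disjoint_iff) (metis top_node_in_nodes)+
  with Nd show ?case by (auto dest: child_rel_nodes child_rel_not_top_node)
qed auto

lemma child_rel_total: "v \<in> nodes T \<Longrightarrow> v \<noteq> top_node T \<Longrightarrow> v \<in> Domain (child_rel T)"
  by (induction T) auto

lemma child_rel_reach: "v \<in> nodes T \<Longrightarrow> (v, top_node T) \<in> (child_rel T)\<^sup>*"
proof (induction T)
  case (Nd x l r)
  have l: "(top_node l, x) \<in> child_rel (Nd x l r)" and r: "(top_node r, x) \<in> child_rel (Nd x l r)"
    by auto
  have sub: "(child_rel l)\<^sup>* \<subseteq> (child_rel (Nd x l r))\<^sup>*" "(child_rel r)\<^sup>* \<subseteq> (child_rel (Nd x l r))\<^sup>*"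
    by (intro rtrancl_mono; auto)+
  from Nd.prems consider "v = x" | "v \<in> nodes l" | "v \<in> nodes r" by auto
  then show ?case
  proof cases
    case 2
    then have "(v, top_node l) \<in> (child_rel (Nd x l r))\<^sup>*" using Nd.IH(1) sub(1) by blast
    with l have "(v, x) \<in> (child_rel (Nd x l r))\<^sup>*" by (rule rtrancl.rtrancl_into_rtrancl[rotated])
    then show ?thesis by simp
  next
    case 3
    then have "(v, top_node r) \<in> (child_rel (Nd x l r))\<^sup>*" using Nd.IH(2) sub(2) by blast
    with r have "(v, x) \<in> (child_rel (Nd x l r))\<^sup>*" by (rule rtrancl.rtrancl_into_rtrancl[rotated])
    then show ?thesis by simp
  qed auto
qed auto

definition tree_parent :: "itree \<Rightarrow> nat \<Rightarrow> nat option" where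
  "tree_parent T w = (if w \<in> Domain (child_rel T) then Some (THE a. (w, a) \<in> child_rel T) else None)"

definition child_list :: "itree \<Rightarrow> nat \<Rightarrow> nat list" where
  "child_list T v = (if v \<in> fst ` branchings T then (THE l. \<exists>b c. (v, b, c) \<in> branchings T \<and> l = [b, c]) else [])"

lemma tree_parent_Some_iff: "distinct_nodes T \<Longrightarrow> tree_parent T w = Some a \<longleftrightarrow> (w, a) \<in> child_rel T"
proof -
  assume d: "distinct_nodes T"
  have "(THE a. (w, a) \<in> child_rel T) = b" if "(w, b) \<in> child_rel T" for b
    by (rule the_equality) (use that child_rel_unique[OF d] in auto)
  then show ?thesis by (auto simp: tree_parent_def)
qed

lemma child_list_branch: "distinct_nodes T \<Longrightarrow> (v, b, c) \<in> branchings T \<Longrightarrow> child_list T v = [b, c]"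
proof -
  assume d: "distinct_nodes T" and b: "(v, b, c) \<in> branchings T"
  have "(THE l. \<exists>b c. (v, b, c) \<in> branchings T \<and> l = [b, c]) = [b, c]"
    by (rule the_equality) (use b branchings_unique_parent[OF d b] in blast)+
  moreover have "v \<in> fst ` branchings T" using b by force
  ultimately show ?thesis by (simp add: child_list_def)
qed

lemma child_list_leaf: "v \<notin> fst ` branchings T \<Longrightarrow> child_list T v = []"
  by (simp add: child_list_def)

lemma set_child_list: "distinct_nodes T \<Longrightarrow> set (child_list T v) = {w. (w, v) \<in> child_rel T}"
proof (cases "v \<in> fst ` branchings T")
  case True
  assume d: "distinct_nodes T"
  from True obtain b c where bc: "(v, b, c) \<in> branchings T" by auto
  with d have "set (child_list T v) = {b, c}" by (simp add: child_list_branch)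
  also have "\<dots> = {w. (w, v) \<in> child_rel T}"
    using bc by (auto simp: child_rel_def dest: branchings_unique_parent[OF d])
  finally show ?thesis .
next
  case False
  then show ?thesis by (auto simp: child_list_leaf child_rel_def intro: rev_image_eqI)
qed

lemma distinct_child_list: "distinct_nodes T \<Longrightarrow> distinct (child_list T v)"
  by (cases "v \<in> fst ` branchings T") (auto simp: child_list_branch child_list_leaf dest: branchings_distinct)

lemma length_child_list: "distinct_nodes T \<Longrightarrow> length (child_list T v) = (if v \<in> fst ` branchings T then 2 else 0)"
  by (cases "v \<in> fst ` branchings T") (auto simp: child_list_branch child_list_leaf)

text \<open>Node names double as identifiers, so different trees over one node set are different
  inputs with the same \<open>n\<close> and the same identifiers.\<close>

definition net :: "itree \<Rightarrow> network" where
  "net T = \<lparr>verts = nodes T, root_node = top_node T, parent = tree_parent T, ident = (\<lambda>v. v),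
     ports = (\<lambda>v. child_list T v @ (case tree_parent T v of None \<Rightarrow> [] | Some u \<Rightarrow> [u]))\<rparr>"

lemma children_net: "distinct_nodes T \<Longrightarrow> children (net T) v = set (child_list T v)"
  by (auto simp: children_def net_def tree_parent_Some_iff set_child_list dest: child_rel_nodes)

lemma tree_parent_None_iff: "distinct_nodes T \<Longrightarrow> v \<in> nodes T \<Longrightarrow> tree_parent T v = None \<longleftrightarrow> v = top_node T"
  by (auto simp: tree_parent_def dest: child_rel_not_top_node child_rel_total)

lemma net_is_full_tree:
  assumes "distinct_nodes T"
  shows "is_full_tree 2 (net T)"
proof -
  have "child_rel T = {(w, u). w \<in> verts (net T) \<and> parent (net T) w = Some u}"
    using assms by (auto simp: net_def tree_parent_Some_iff dest: child_rel_nodes)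
  moreover have "\<exists>u\<in>nodes T. tree_parent T v = Some u" if "v \<in> nodes T" "v \<noteq> top_node T" for v
    using child_rel_total[OF that] assms by (auto simp: tree_parent_Some_iff dest: child_rel_nodes)
  moreover have "card (set (child_list T v)) = 0 \<or> card (set (child_list T v)) = 2" for v
    using assms by (simp add: distinct_card distinct_child_list length_child_list)
  moreover have "tree_parent T (top_node T) = None" using assms by (simp add: tree_parent_None_iff)
  ultimately show ?thesis
    using child_rel_reach[of _ T] assms
    unfolding is_full_tree_def is_rooted_tree_def children_net[OF assms]
    by (simp add: net_def)
qed

lemma net_in_networks:
  assumes "distinct_nodes T" and "nodes T = {1..n}" and "c \<ge> 1"
  shows "net T \<in> networks c 2 n"
proof -
  have "n \<le> n ^ c" using assms(3) by (cases "n = 0") (auto simp: self_le_power)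
  moreover have "u \<notin> set (child_list T v)" if "tree_parent T v = Some u" for u v
    using that assms(1) by (auto simp: tree_parent_Some_iff set_child_list dest: child_rel_asym)
  ultimately show ?thesis
    using assms net_is_full_tree[OF assms(1)]
    by (auto simp: networks_def neighbours_def children_net)
       (auto simp: net_def distinct_child_list split: option.splits)
qed

section \<open>Locality\<close>

text \<open>\<open>G r\<close> is a region in which \<open>r\<close> rounds cannot reveal a
  difference: one round at a vertex uses only earlier data of the vertex and its neighbours, which
  by \<open>step\<close> lie in the preceding, larger region. Equal vertex sets and degrees make
  \<open>n\<close> and the maximum degree, known everywhere, coincide.\<close>

lemma history_agree:
  assumes verts: "verts N = verts N'"
    and deg: "\<And>v. v \<in> verts N \<Longrightarrow> length (ports N v) = length (ports N' v)"
    and agree: "\<And>r v. v \<in> G r \<Longrightarrow> ident N v = ident N' v \<and> parent N v = parent N' v \<and> ports N v = ports N' v"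
    and step: "\<And>r v. v \<in> G (Suc r) \<Longrightarrow> v \<in> G r \<and> set (ports N v) \<subseteq> G r"
  shows "v \<in> G t \<Longrightarrow> initial_knowledge N v = initial_knowledge N' v \<and> history_of A N t v = history_of A N' t v"
proof (induction t arbitrary: v)
  case 0
  have "(\<lambda>u. length (ports N u)) ` verts N = (\<lambda>u. length (ports N' u)) ` verts N'"
    using deg verts by (metis image_cong)
  then show ?case
    using agree[OF 0] verts by (simp add: initial_knowledge_def port_to_def[abs_def])
next
  case (Suc t)
  have v: "v \<in> G t" and nb: "set (ports N v) \<subseteq> G t" using step[OF Suc.prems] by auto
  have "port_to N w = port_to N' w" if "w \<in> G t" for w
    using agree[OF that] by (simp add: port_to_def fun_eq_iff)
  then have "map (\<lambda>w. send A (initial_knowledge N w) (history_of A N t w) (port_to N w v)) (ports N v) =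
      map (\<lambda>w. send A (initial_knowledge N' w) (history_of A N' t w) (port_to N' w v)) (ports N' v)"
    using Suc.IH nb agree[OF v] by (auto simp: subset_iff)
  with Suc.IH[OF v] show ?case by simp
qed

lemma output_agree:
  assumes verts: "verts N = verts N'"
    and deg: "\<And>v. v \<in> verts N \<Longrightarrow> length (ports N v) = length (ports N' v)"
    and agree: "\<And>r v. v \<in> G r \<Longrightarrow> ident N v = ident N' v \<and> parent N v = parent N' v \<and> ports N v = ports N' v"
    and step: "\<And>r v. v \<in> G (Suc r) \<Longrightarrow> v \<in> G r \<and> set (ports N v) \<subseteq> G r"
    and v: "v \<in> G t" and s: "s \<le> t" "decision A N s v \<noteq> None"
  shows "output_label A N v = output_label A N' v"
proof -
  have eq: "decision A N r v = decision A N' r v" if "r \<le> t" for r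
  proof -
    \<comment> \<open>The regions shrink as \<open>r\<close> grows, so membership in
      \<open>G t\<close> is carried down to all earlier indices.\<close>
    have "d \<le> t \<Longrightarrow> v \<in> G (t - d)" for d
    proof (induction d)
      case (Suc d)
      then have "v \<in> G (Suc (t - Suc d))" by (simp add: Suc_diff_Suc)
      then show ?case using step by blast
    qed (use v in simp)
    from this[of "t - r"] have "v \<in> G r" using that by simp
    then show ?thesis
      unfolding decision_def
      using history_agree[of N N' G v r A] verts deg agree step by metis
  qed
  define m where "m = (LEAST r. decision A N r v \<noteq> None)"
  have m: "decision A N m v \<noteq> None" unfolding m_def by (rule LeastI[where P = "\<lambda>r. decision A N r v \<noteq> None", OF s(2)])
  have "m \<le> s" unfolding m_def by (rule Least_le[where P = "\<lambda>r. decision A N r v \<noteq> None", OF s(2)])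
  then have mt: "m \<le> t" using s(1) by simp
  \<comment> \<open>The output is the first decision, so an earlier decision of \<open>v\<close> in
    \<open>N'\<close> has to be excluded as well; agreement up to round \<open>t\<close> does
    this.\<close>
  have "(LEAST r. decision A N' r v \<noteq> None) = m"
  proof (rule Least_equality)
    show "decision A N' m v \<noteq> None" using m eq[OF mt] by simp
    fix r assume r: "decision A N' r v \<noteq> None"
    show "m \<le> r"
    proof (rule ccontr)
      assume "\<not> m \<le> r"
      then have "r < m" "r \<le> t" using mt by auto
      then have "decision A N r v \<noteq> None" using r eq by simp
      then show False using \<open>r < m\<close> not_less_Least unfolding m_def by blast
    qed
  qed
  then show ?thesis
    unfolding output_label_def m_def[symmetric] using eq[OF mt] by simp
qed

text \<open>A potential \<open>f\<close> that changes by at most 1 along edges bounds distances from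
  below: the ball of radius \<open>t\<close> around \<open>v\<close> lies in the window of
  potentials within \<open>t\<close> of \<open>f v\<close>. If every triple meeting this window
  survives in \<open>T'\<close>, a vertex deciding within \<open>t\<close> rounds cannot tell the
  trees apart.\<close>

lemma net_output_agree:
  fixes f :: "nat \<Rightarrow> int"
  assumes d: "distinct_nodes T" "distinct_nodes T'" and nod: "nodes T = nodes T'" and top_node: "top_node T = top_node T'"
    and tree_parent: "fst ` branchings T = fst ` branchings T'"
    and lip: "\<And>a b c. (a, b, c) \<in> branchings T \<Longrightarrow> \<bar>f a - f b\<bar> \<le> 1 \<and> \<bar>f a - f c\<bar> \<le> 1"
    and near: "\<And>a b c x. (a, b, c) \<in> branchings T \<Longrightarrow> x \<in> {a, b, c} \<Longrightarrow> \<bar>f x - f v\<bar> \<le> int t \<Longrightarrow> (a, b, c) \<in> branchings T'"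
    and v: "v \<in> nodes T" and s: "s \<le> t" "decision A (net T) s v \<noteq> None"
  shows "output_label A (net T) v = output_label A (net T') v"
proof -
  \<comment> \<open>Contains the ball of radius \<open>t - r\<close> around \<open>v\<close>: each
    round costs one unit of potential.\<close>
  define G where "G r = {u \<in> nodes T. \<bar>f u - f v\<bar> + int r \<le> int t}" for r
  have child_list: "child_list T u = child_list T' u" if "u \<in> G r" for r u
  proof (cases "u \<in> fst ` branchings T")
    case True
    then obtain b c where bc: "(u, b, c) \<in> branchings T" by auto
    then have "(u, b, c) \<in> branchings T'" using near[of u b c u] that by (auto simp: G_def)
    with bc d show ?thesis by (simp add: child_list_branch)
  qed (use tree_parent in \<open>auto simp: child_list_leaf\<close>)
  have par_eq: "tree_parent T u = tree_parent T' u" if "u \<in> G r" for r u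
  proof (cases "u = top_node T")
    case True
    then show ?thesis using d top_node nod tree_parent_None_iff top_node_in_nodes by metis
  next
    case False
    then obtain a where a: "(u, a) \<in> child_rel T" using child_rel_total[of u T] \<open>u \<in> G r\<close> by (auto simp: G_def)
    then obtain b where "(a, u, b) \<in> branchings T \<or> (a, b, u) \<in> branchings T" by (auto simp: child_rel_def)
    then have "(a, u, b) \<in> branchings T' \<or> (a, b, u) \<in> branchings T'"
      using near[of a u b u] near[of a b u u] that by (auto simp: G_def)
    then have "(u, a) \<in> child_rel T'" by (auto simp: child_rel_def)
    with a d show ?thesis by (metis tree_parent_Some_iff)
  qed
  show ?thesis
  proof (rule output_agree[where G = G and s = s and t = t])
    show "verts (net T) = verts (net T')" using nod by (simp add: net_def)
    show "length (ports (net T) u) = length (ports (net T') u)" if "u \<in> verts (net T)" for u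
    proof -
      \<comment> \<open>Degrees depend only on being a branching vertex and on being the top, and
        the two trees agree in both.\<close>
      have "tree_parent T u = None \<longleftrightarrow> tree_parent T' u = None"
        using that d nod top_node by (simp add: net_def tree_parent_None_iff)
      then show ?thesis using d tree_parent by (auto simp: net_def length_child_list split: option.splits)
    qed
    show "ident (net T) u = ident (net T') u \<and> parent (net T) u = parent (net T') u \<and>
        ports (net T) u = ports (net T') u" if "u \<in> G r" for r u
      using child_list[OF that] par_eq[OF that] by (simp add: net_def)
    show "u \<in> G r \<and> set (ports (net T) u) \<subseteq> G r" if "u \<in> G (Suc r)" for r u
    proof -
      have "w \<in> G r" if w: "(w, u) \<in> child_rel T \<or> (u, w) \<in> child_rel T" for w
      proof -
        have "\<bar>f u - f w\<bar> \<le> 1"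
          using w lip by (auto simp: child_rel_def) (metis abs_minus_commute)+
        then show ?thesis using w \<open>u \<in> G (Suc r)\<close> by (auto simp: G_def dest: child_rel_nodes)
      qed
      then show ?thesis
        using \<open>u \<in> G (Suc r)\<close> d
        by (auto simp: G_def net_def set_child_list tree_parent_Some_iff eq_commute[of "Some _" "tree_parent T u"]
            split: option.splits)
    qed
    show "v \<in> G t" using v by (simp add: G_def)
  qed (use s in auto)
qed


section \<open>Spines\<close>

text \<open>Trees with a hole, represented by the functions that fill it. They let an induction on a
  subtree \<open>S\<close> speak about labels, which exist only for the whole input
  \<open>C S\<close>.\<close>

inductive is_ctxt :: "(itree \<Rightarrow> itree) \<Rightarrow> bool" where
  ctxt_hole: "is_ctxt (\<lambda>X. X)"
| ctxt_left: "is_ctxt C \<Longrightarrow> is_ctxt (\<lambda>X. Nd a (C X) r)"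
| ctxt_right: "is_ctxt C \<Longrightarrow> is_ctxt (\<lambda>X. Nd a l (C X))"

lemma is_ctxt_comp: "is_ctxt C \<Longrightarrow> is_ctxt D \<Longrightarrow> is_ctxt (\<lambda>X. C (D X))"
  by (induction rule: is_ctxt.induct) (auto intro: is_ctxt.intros)

lemma ctxt_replace:
  assumes "is_ctxt C" and "top_node S = top_node S'" and "nodes S = nodes S'" and "distinct_nodes S'"
    and "distinct_nodes (C S)"
  shows "top_node (C S) = top_node (C S') \<and> nodes (C S) = nodes (C S') \<and> distinct_nodes (C S')"
  using assms by (induction rule: is_ctxt.induct) auto

lemma ctxt_distinct: "is_ctxt C \<Longrightarrow> distinct_nodes (C S) \<Longrightarrow> distinct_nodes S"
  by (induction rule: is_ctxt.induct) auto

lemma ctxt_nodes: "is_ctxt C \<Longrightarrow> nodes S \<subseteq> nodes (C S)"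
  by (induction rule: is_ctxt.induct) auto

lemma ctxt_branchings_subset: "is_ctxt C \<Longrightarrow> branchings S \<subseteq> branchings (C S)"
  by (induction rule: is_ctxt.induct) auto

text \<open>Only the top of the filling is visible from outside the hole, so fillings with equal
  tops share the outer triples \<open>Z\<close>, and these meet the filling at most in its
  top.\<close>

lemma ctxt_branchings:
  assumes "is_ctxt C" and "top_node S = top_node S'" and "distinct_nodes (C S)"
  shows "\<exists>Z. branchings (C S) = Z \<union> branchings S \<and> branchings (C S') = Z \<union> branchings S' \<and>
    (\<forall>(a, b, c) \<in> Z. a \<notin> nodes S \<and> (b \<in> nodes S \<longrightarrow> b = top_node S) \<and> (c \<in> nodes S \<longrightarrow> c = top_node S))"
  using assms
proof (induction rule: is_ctxt.induct)
  case ctxt_hole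
  then show ?case by (intro exI[of _ "{}"]) auto
next
  case (ctxt_left C a r)
  then obtain Z where Z: "branchings (C S) = Z \<union> branchings S" "branchings (C S') = Z \<union> branchings S'"
    "\<forall>(a, b, c) \<in> Z. a \<notin> nodes S \<and> (b \<in> nodes S \<longrightarrow> b = top_node S) \<and> (c \<in> nodes S \<longrightarrow> c = top_node S)"
    by auto
  have sub: "nodes S \<subseteq> nodes (C S)" using ctxt_left by (simp add: ctxt_nodes)
  then have dis: "\<And>x. x \<in> nodes r \<Longrightarrow> x \<notin> nodes S" "a \<notin> nodes S" using ctxt_left.prems by auto
  have root: "top_node (C S') = top_node (C S)" "top_node (C S) \<in> nodes S \<Longrightarrow> top_node (C S) = top_node S"
    using ctxt_left.hyps ctxt_left.prems
    by (induction rule: is_ctxt.induct) (auto dest: ctxt_nodes)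
  show ?case
    by (rule exI[of _ "insert (a, top_node (C S), top_node r) (Z \<union> branchings r)"])
       (use Z root dis in \<open>auto dest: branchings_nodes\<close>)
next
  case (ctxt_right C a l)
  then obtain Z where Z: "branchings (C S) = Z \<union> branchings S" "branchings (C S') = Z \<union> branchings S'"
    "\<forall>(a, b, c) \<in> Z. a \<notin> nodes S \<and> (b \<in> nodes S \<longrightarrow> b = top_node S) \<and> (c \<in> nodes S \<longrightarrow> c = top_node S)"
    by auto
  have sub: "nodes S \<subseteq> nodes (C S)" using ctxt_right by (simp add: ctxt_nodes)
  then have dis: "\<And>x. x \<in> nodes l \<Longrightarrow> x \<notin> nodes S" "a \<notin> nodes S" using ctxt_right.prems by auto
  have root: "top_node (C S') = top_node (C S)" "top_node (C S) \<in> nodes S \<Longrightarrow> top_node (C S) = top_node S"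
    using ctxt_right.hyps ctxt_right.prems
    by (induction rule: is_ctxt.induct) (auto dest: ctxt_nodes)
  show ?case
    by (rule exI[of _ "insert (a, top_node l, top_node (C S)) (Z \<union> branchings l)"])
       (use Z root dis in \<open>auto dest: branchings_nodes\<close>)
qed

text \<open>An item is a spine vertex together with the tree hanging from it on the right; the spine
  runs to the left and ends in \<open>E\<close>.\<close>

primrec spine :: "(nat \<times> itree) list \<Rightarrow> itree \<Rightarrow> itree" where
  "spine [] E = E"
| "spine (x # xs) E = Nd (fst x) (spine xs E) (snd x)"

lemma spine_append: "spine (xs @ ys) E = spine xs (spine ys E)"
  by (induction xs) auto

lemma top_node_spine: "top_node (spine xs E) = (if xs = [] then top_node E else fst (hd xs))"
  by (cases xs) auto

lemma is_ctxt_spine: "is_ctxt (spine xs)"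
proof (induction xs)
  case Nil
  have "spine [] = (\<lambda>X. X)" by auto
  then show ?case by (simp add: ctxt_hole)
next
  case (Cons x xs)
  have "spine (x # xs) = (\<lambda>X. Nd (fst x) (spine xs X) (snd x))" by auto
  with Cons show ?case by (simp add: ctxt_left)
qed

definition item_nodes :: "nat \<times> itree \<Rightarrow> nat set" where
  "item_nodes x = insert (fst x) (nodes (snd x))"

lemma nodes_spine: "nodes (spine xs E) = \<Union> (item_nodes ` set xs) \<union> nodes E"
  by (induction xs) (auto simp: item_nodes_def)

text \<open>Counting nodes with multiplicity turns distinctness into a property of a multiset, which
  is invariant under permuting the items of a spine.\<close>

primrec node_mset :: "itree \<Rightarrow> nat multiset" where
  "node_mset (Lf a) = {#a#}"
| "node_mset (Nd a l r) = add_mset a (node_mset l + node_mset r)"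

lemma set_node_mset [simp]: "set_mset (node_mset T) = nodes T"
  by (induction T) auto

lemma distinct_nodes_iff: "distinct_nodes T \<longleftrightarrow> (\<forall>v. count (node_mset T) v \<le> 1)"
proof (induction T)
  case (Nd a l r)
  have mem: "count (node_mset S) v = 0 \<longleftrightarrow> v \<notin> nodes S" for S v
    by (simp add: count_eq_zero_iff)
  show ?case
  proof
    assume d: "distinct_nodes (Nd a l r)"
    show "\<forall>v. count (node_mset (Nd a l r)) v \<le> 1"
    proof
      fix v
      have "count (node_mset l) v \<le> 1" "count (node_mset r) v \<le> 1" using d Nd by auto
      moreover have "v = a \<longrightarrow> count (node_mset l) v = 0 \<and> count (node_mset r) v = 0"
        "count (node_mset l) v = 0 \<or> count (node_mset r) v = 0"
        using d by (auto simp: mem)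
      ultimately show "count (node_mset (Nd a l r)) v \<le> 1" by auto
    qed
  next
    assume c: "\<forall>v. count (node_mset (Nd a l r)) v \<le> 1"
    have sum: "count (node_mset l) v + count (node_mset r) v + (if v = a then 1 else 0) \<le> 1" for v
      using c[rule_format, of v] by (simp split: if_splits)
    have c': "count (node_mset l) v \<le> 1" "count (node_mset r) v \<le> 1"
      "v = a \<Longrightarrow> count (node_mset l) v = 0" "v = a \<Longrightarrow> count (node_mset r) v = 0"
      "count (node_mset l) v = 0 \<or> count (node_mset r) v = 0" for v
      using sum[of v] by arith+
    then show "distinct_nodes (Nd a l r)"
      using Nd by (auto simp: mem)
  qed
qed simp

lemma node_mset_spine:
  "node_mset (spine xs E) = \<Sum>\<^sub># (image_mset (\<lambda>x. add_mset (fst x) (node_mset (snd x))) (mset xs)) + node_mset E"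
  by (induction xs) (auto simp: ac_simps)

lemma spine_rearrange:
  assumes "mset xs = mset ys"
  shows "nodes (spine xs E) = nodes (spine ys E)"
    and "distinct_nodes (spine xs E) \<longleftrightarrow> distinct_nodes (spine ys E)"
proof -
  have "node_mset (spine xs E) = node_mset (spine ys E)"
    using assms by (simp add: node_mset_spine)
  then show "nodes (spine xs E) = nodes (spine ys E)"
    and "distinct_nodes (spine xs E) \<longleftrightarrow> distinct_nodes (spine ys E)"
    by (metis set_node_mset, simp add: distinct_nodes_iff)
qed

text \<open>The vertex \<open>e\<close> following the list is a parameter because only the triple of
  the last item depends on it. Cutting and regluing spines thus affects one triple per cut.\<close>

primrec spine_branchings :: "(nat \<times> itree) list \<Rightarrow> nat \<Rightarrow> (nat \<times> nat \<times> nat) set" where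
  "spine_branchings [] e = {}"
| "spine_branchings (x # xs) e =
     insert (fst x, if xs = [] then e else fst (hd xs), top_node (snd x)) (branchings (snd x) \<union> spine_branchings xs e)"

lemma branchings_spine: "branchings (spine xs E) = spine_branchings xs (top_node E) \<union> branchings E"
  by (induction xs) (auto simp: top_node_spine)

lemma spine_branchings_change_end:
  "(a, b, c) \<in> spine_branchings xs e \<Longrightarrow> (a, b, c) \<in> spine_branchings xs e' \<or> a = fst (last xs)"
  by (induction xs) (auto split: if_splits)

lemma spine_branchings_parents: "fst ` spine_branchings xs e = fst ` spine_branchings xs e'"
  by (induction xs) (auto simp: image_Un)

lemma spine_nth_branchings:
  "Suc j < length xs \<Longrightarrow> (fst (xs ! j), fst (xs ! Suc j), top_node (snd (xs ! j))) \<in> branchings (spine xs E)"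
proof (induction xs arbitrary: j)
  case (Cons x xs)
  show ?case
  proof (cases j)
    case 0
    then show ?thesis using Cons.prems by (cases xs) auto
  next
    case (Suc i)
    then show ?thesis using Cons by auto
  qed
qed auto

text \<open>Everything hanging from the \<open>j\<close>-th spine vertex gets index \<open>j\<close>, which makes the index 1-Lipschitz.\<close>

primrec spine_index :: "(nat \<times> itree) list \<Rightarrow> nat \<Rightarrow> nat" where
  "spine_index [] v = 0"
| "spine_index (x # xs) v = (if v \<in> item_nodes x then 0 else Suc (spine_index xs v))"

lemma spine_index_top_node: "spine_index xs (top_node (spine xs E)) = 0"
  by (cases xs) (auto simp: item_nodes_def)

lemma spine_index_nth: "distinct_nodes (spine xs E) \<Longrightarrow> j < length xs \<Longrightarrow> spine_index xs (fst (xs ! j)) = j"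
proof (induction xs arbitrary: j)
  case (Cons x xs)
  show ?case
  proof (cases j)
    case (Suc i)
    then have "fst (xs ! i) \<in> nodes (spine xs E)"
      using Cons.prems by (auto simp: nodes_spine item_nodes_def)
    then show ?thesis using Cons Suc by (auto simp: item_nodes_def)
  qed (simp add: item_nodes_def)
qed auto

lemma spine_index_lipschitz:
  "distinct_nodes (spine xs E) \<Longrightarrow> (a, b, c) \<in> branchings (spine xs E) \<Longrightarrow>
     \<bar>int (spine_index xs a) - int (spine_index xs b)\<bar> \<le> 1 \<and> \<bar>int (spine_index xs a) - int (spine_index xs c)\<bar> \<le> 1"
proof (induction xs)
  case (Cons x xs)
  have out: "v \<notin> item_nodes x" if "v \<in> nodes (spine xs E)" for v
    using that Cons.prems(1) by (auto simp: item_nodes_def)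
  from Cons.prems(2) consider "(a, b, c) = (fst x, top_node (spine xs E), top_node (snd x))"
    | "(a, b, c) \<in> branchings (spine xs E)" | "(a, b, c) \<in> branchings (snd x)" by auto
  then show ?case
  proof cases
    case 1
    then show ?thesis using out[of "top_node (spine xs E)"] spine_index_top_node[of xs E] by (auto simp: item_nodes_def)
  next
    case 2
    then show ?thesis using Cons branchings_nodes[OF 2] out by auto
  next
    case 3
    then show ?thesis using branchings_nodes[OF 3] by (auto simp: item_nodes_def)
  qed
qed auto

section \<open>The lower bound\<close>

text \<open>Configuration (iii) draws its restricted child from this set; for \<open>i = k\<close>
  it is all of \<open>Sigma_k k\<close>.\<close>

definition level_set :: "nat \<Rightarrow> label set" where
  "level_set i = below i \<union> {LabA i, LabB i}"

primrec flip :: "label \<Rightarrow> label" where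
  "flip (LabA i) = LabB i"
| "flip (LabB i) = LabA i"
| "flip (LabX i) = LabX i"

text \<open>The nested spines of the lower bound, of rank given by the second argument. The end
  \<open>E\<close> is arbitrary and can absorb leftover vertices, so that all large odd sizes
  occur.\<close>

primrec rich :: "nat \<Rightarrow> nat \<Rightarrow> itree \<Rightarrow> bool" where
  "rich L 0 S \<longleftrightarrow> True"
| "rich L (Suc i) S \<longleftrightarrow> (\<exists>xs E. S = spine xs E \<and> length xs = L \<and> (\<forall>x \<in> set xs. rich L i (snd x)))"

lemma below_mono: "i \<le> j \<Longrightarrow> below i \<subseteq> below j"
  by (force simp: below_def)

lemma below_iff:
  "LabA m \<in> below i \<longleftrightarrow> 1 \<le> m \<and> m < i"
  "LabB m \<in> below i \<longleftrightarrow> 1 \<le> m \<and> m < i"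
  "LabX m \<in> below i \<longleftrightarrow> 1 \<le> m \<and> m < i"
  by (auto simp: below_def)

lemma below_cases:
  assumes "l \<in> below i"
  obtains m where "1 \<le> m" "m < i" "l = LabA m \<or> l = LabB m \<or> l = LabX m"
  using assms by (auto simp: below_def)

lemma level_set_mono: "1 \<le> m \<Longrightarrow> m \<le> i \<Longrightarrow> level_set m \<subseteq> level_set i"
  using below_mono[of m i] by (cases "m = i") (auto simp: level_set_def below_iff)

definition allowed :: "nat \<Rightarrow> label \<Rightarrow> label \<Rightarrow> label \<Rightarrow> bool" where
  "allowed k a b c \<longleftrightarrow> (a, [b, c]) \<in> configs (Pi_k k) \<or> (a, [c, b]) \<in> configs (Pi_k k)"

lemma allowed_A: "allowed k (LabA i) b c \<longleftrightarrow>
    1 \<le> i \<and> i \<le> k \<and> b \<in> below i \<union> {LabB i} \<and> c \<in> below i \<union> {LabB i}"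
  by (auto simp: allowed_def Pi_k_def)

lemma allowed_B: "allowed k (LabB i) b c \<longleftrightarrow>
    1 \<le> i \<and> i \<le> k \<and> b \<in> below i \<union> {LabA i} \<and> c \<in> below i \<union> {LabA i}"
  by (auto simp: allowed_def Pi_k_def)

lemma allowed_X: "allowed k (LabX i) b c \<longleftrightarrow> 1 \<le> i \<and> i < k \<and>
    (b \<in> Sigma_k k \<and> c \<in> level_set i \<or> c \<in> Sigma_k k \<and> b \<in> level_set i)"
  by (auto simp: allowed_def Pi_k_def level_set_def)

text \<open>\<open>LabA m\<close> and \<open>LabB m\<close> restrict both children to
  \<open>level_set m\<close>, which \<open>c\<close> violates. So \<open>a\<close> is some
  \<open>LabX m\<close>, and the restricted child has to be \<open>b\<close>.\<close>

lemma allowed_level: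
  assumes "allowed k a b c" and "1 \<le> i" and "a \<in> below (Suc i)" and "c \<notin> level_set i"
  shows "\<exists>m. 1 \<le> m \<and> m \<le> i \<and> a = LabX m \<and> b \<in> level_set m"
proof -
  from assms(3) obtain m where m: "1 \<le> m" "m \<le> i" "a = LabA m \<or> a = LabB m \<or> a = LabX m"
    by (auto elim: below_cases)
  then have "c \<notin> level_set m" using assms(4) level_set_mono by blast
  then show ?thesis using m assms(1) by (auto simp: allowed_A allowed_B allowed_X level_set_def)
qed

text \<open>Abstracts a \<open>t\<close>-round algorithm to what the argument uses: correct labels
  on every tree over the fixed node set \<open>V\<close>, and the indistinguishability provided by
  \<open>net_output_agree\<close>.\<close>

locale local_labelling =
  fixes lab :: "itree \<Rightarrow> nat \<Rightarrow> label" and V :: "nat set" and k t :: nat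
  assumes k_pos: "k \<ge> 1"
    and lab_Sigma: "distinct_nodes T \<Longrightarrow> nodes T = V \<Longrightarrow> v \<in> V \<Longrightarrow> lab T v \<in> Sigma_k k"
    and lab_allowed: "distinct_nodes T \<Longrightarrow> nodes T = V \<Longrightarrow> (a, b, c) \<in> branchings T \<Longrightarrow>
      allowed k (lab T a) (lab T b) (lab T c)"
    and lab_local: "\<And>(f :: nat \<Rightarrow> int) T T' v. distinct_nodes T \<Longrightarrow> distinct_nodes T' \<Longrightarrow>
      nodes T = V \<Longrightarrow> nodes T' = V \<Longrightarrow> top_node T = top_node T' \<Longrightarrow> fst ` branchings T = fst ` branchings T' \<Longrightarrow>
      (\<And>a b c. (a, b, c) \<in> branchings T \<Longrightarrow> \<bar>f a - f b\<bar> \<le> 1 \<and> \<bar>f a - f c\<bar> \<le> 1) \<Longrightarrow>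
      (\<And>a b c x. (a, b, c) \<in> branchings T \<Longrightarrow> x \<in> {a, b, c} \<Longrightarrow> \<bar>f x - f v\<bar> \<le> int t \<Longrightarrow>
         (a, b, c) \<in> branchings T') \<Longrightarrow>
      v \<in> V \<Longrightarrow> lab T v = lab T' v"
begin

text \<open>As no hanging child helps, a spine vertex with a label of level at most \<open>m\<close>
  must carry an x-label, and the next spine vertex a label of strictly smaller level. With
  \<open>m + 1\<close> further spine vertices the levels run out before the spine does.\<close>

lemma spine_not_below:
  assumes T: "distinct_nodes (C (spine xs E))" "nodes (C (spine xs E)) = V" "is_ctxt C"
    and hang: "\<And>x. x \<in> set xs \<Longrightarrow> lab (C (spine xs E)) (top_node (snd x)) \<notin> level_set i"
  shows "m \<le> i \<Longrightarrow> j + m + 1 < length xs \<Longrightarrow> lab (C (spine xs E)) (fst (xs ! j)) \<notin> below (Suc m)"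
proof (induction m arbitrary: j)
  case 0
  then show ?case by (auto simp: below_def)
next
  case (Suc m)
  let ?l = "lab (C (spine xs E))"
  have al: "allowed k (?l (fst (xs ! j))) (?l (fst (xs ! Suc j))) (?l (top_node (snd (xs ! j))))"
    if "Suc j < length xs" for j
    using lab_allowed[OF T(1,2)] spine_nth_branchings[OF that] ctxt_branchings_subset[OF T(3)] by blast
  have i: "1 \<le> i" using Suc.prems by simp
  show ?case
  proof
    assume "?l (fst (xs ! j)) \<in> below (Suc (Suc m))"
    moreover have "?l (top_node (snd (xs ! j))) \<notin> level_set (Suc m)"
      using hang[of "xs ! j"] Suc.prems level_set_mono[of "Suc m" i] by auto
    ultimately obtain m' where m': "1 \<le> m'" "m' \<le> Suc m" "?l (fst (xs ! Suc j)) \<in> level_set m'"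
      using allowed_level[OF al[of j], of "Suc m"] Suc.prems by auto
    \<comment> \<open>Excludes \<open>LabA m'\<close> and \<open>LabB m'\<close> at the next spine
      vertex, since these would also restrict its hanging child. This makes the drop in level
      strict.\<close>
    have "?l (top_node (snd (xs ! Suc j))) \<notin> level_set m'"
      using hang[of "xs ! Suc j"] Suc.prems level_set_mono[of m' i] m' by auto
    then have "?l (fst (xs ! Suc j)) \<in> below m'"
      using al[of "Suc j"] m'(3) Suc.prems by (auto simp: level_set_def allowed_A allowed_B)
    then have "?l (fst (xs ! Suc j)) \<in> below (Suc m)"
      using below_mono[OF m'(2)] by blast
    then show False using Suc.IH[of "Suc j"] Suc.prems by simp
  qed
qed

text \<open>Below \<open>LabA (Suc i)\<close> a spine vertex can only have a lower level or
  \<open>LabB (Suc i)\<close>, and conversely; \<open>spine_not_below\<close> removes the lower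
  levels except near the end of the spine.\<close>

lemma spine_alternates:
  assumes T: "distinct_nodes (C (spine xs E))" "nodes (C (spine xs E)) = V" "is_ctxt C"
    and hang: "\<And>x. x \<in> set xs \<Longrightarrow> lab (C (spine xs E)) (top_node (snd x)) \<notin> level_set i"
    and top: "lab (C (spine xs E)) (fst (xs ! 0)) \<in> {LabA (Suc i), LabB (Suc i)}"
  shows "j + i + 1 < length xs \<Longrightarrow> lab (C (spine xs E)) (fst (xs ! j)) =
    (if even j then lab (C (spine xs E)) (fst (xs ! 0)) else flip (lab (C (spine xs E)) (fst (xs ! 0))))"
proof (induction j)
  case (Suc j)
  let ?l = "lab (C (spine xs E))"
  have "allowed k (?l (fst (xs ! j))) (?l (fst (xs ! Suc j))) (?l (top_node (snd (xs ! j))))"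
    using lab_allowed[OF T(1,2)] spine_nth_branchings[of j xs] ctxt_branchings_subset[OF T(3)] Suc.prems by force
  moreover have "?l (fst (xs ! Suc j)) \<notin> below (Suc i)"
    using spine_not_below[OF T hang, of i "Suc j"] Suc.prems by simp
  ultimately show ?case using Suc top by (auto simp: allowed_A allowed_B)
qed simp

text \<open>The length \<open>3 * t + 8 + k\<close> splits into \<open>t + 3\<close> items
  \<open>A\<close>, \<open>2 * t + 4\<close> items \<open>B\<close>, one item \<open>y\<close> to be
  moved, and a reserve \<open>D\<close> of \<open>k\<close> items for the end of the spine, where
  the labels are not controlled.\<close>

lemma rich_not_level_set:
  assumes "i \<le> k"
  shows "distinct_nodes (C S) \<Longrightarrow> nodes (C S) = V \<Longrightarrow> is_ctxt C \<Longrightarrow> rich (3 * t + 8 + k) i S \<Longrightarrow>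
    lab (C S) (top_node S) \<notin> level_set i"
  using assms
proof (induction i arbitrary: C S)
  case 0
  \<comment> \<open>\<open>level_set 0\<close> consists of \<open>LabA 0\<close> and
    \<open>LabB 0\<close>, while label indices start at 1.\<close>
  have "lab (C S) (top_node S) \<in> Sigma_k k"
    using lab_Sigma 0 ctxt_nodes[of C S] top_node_in_nodes[of S] by blast
  with k_pos show ?case by (auto simp: level_set_def Sigma_k_def below_def)
next
  case (Suc i)
  obtain xs E where S: "S = spine xs E" "length xs = 3 * t + 8 + k" "\<forall>x \<in> set xs. rich (3 * t + 8 + k) i (snd x)"
    using Suc.prems(4) by auto
  define A where "A = take (t + 3) xs"
  define B where "B = take (2 * t + 4) (drop (t + 3) xs)"
  define y where "y = xs ! (3 * t + 7)"
  define D where "D = drop (3 * t + 8) xs"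
  have xs: "xs = A @ B @ [y] @ D"
  proof -
    have "drop (3 * t + 7) xs = y # D"
    proof -
      have "Suc (3 * t + 7) = 3 * t + 8" "3 * t + 7 < length xs" using S(2) by auto
      then show ?thesis unfolding y_def D_def by (metis Cons_nth_drop_Suc)
    qed
    moreover have "2 * t + 4 + (t + 3) = 3 * t + 7" by simp
    then have "drop (2 * t + 4) (drop (t + 3) xs) = drop (3 * t + 7) xs" by (simp only: drop_drop)
    ultimately have "drop (t + 3) xs = B @ y # D" by (metis B_def append_take_drop_id)
    then show ?thesis by (metis A_def append_Cons append_Nil append_take_drop_id)
  qed
  have len: "length A = t + 3" "length B = 2 * t + 4" using S(2) by (auto simp: A_def B_def)
  \<comment> \<open>\<open>y\<close> moves up from behind \<open>B\<close> to the front of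
    \<open>B\<close>.\<close>
  define ys where "ys = A @ [y] @ B @ D"
  define S' where "S' = spine ys E"
  \<comment> \<open>Induction hypothesis for the hanging trees, with the rest of the spine absorbed
    into the context \<open>C'\<close>. It is stated for all permutations because both orders are
    needed.\<close>
  have hang: "lab (C (spine zs E)) (top_node (snd x)) \<notin> level_set i"
    if zs: "mset zs = mset xs" "distinct_nodes (C (spine zs E))" "nodes (C (spine zs E)) = V" "x \<in> set zs"
    for zs x
  proof -
    obtain us vs where us: "zs = us @ x # vs" using split_list[OF zs(4)] by blast
    define C' where "C' X = C (spine us (Nd (fst x) (spine vs E) X))" for X
    have "is_ctxt (\<lambda>X. Nd (fst x) (spine vs E) X)" by (rule ctxt_right[OF ctxt_hole])
    then have "is_ctxt C'"
      unfolding C'_def by (intro is_ctxt_comp[OF Suc.prems(3)] is_ctxt_comp[OF is_ctxt_spine])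
    moreover have eq: "C' (snd x) = C (spine zs E)" by (simp add: C'_def us spine_append)
    moreover have "rich (3 * t + 8 + k) i (snd x)"
      using S(3) mset_eq_setD[OF zs(1)] zs(4) by auto
    ultimately show ?thesis using Suc.IH[of C' "snd x"] zs Suc.prems by simp
  qed
  have ms: "mset ys = mset xs" by (simp add: xs ys_def)
  have Ane: "A \<noteq> []" "B \<noteq> []" using len by auto
  have rtS: "top_node S = top_node S'" using Ane by (simp add: S S'_def top_node_spine xs ys_def)
  have hd0: "xs ! 0 = A ! 0" "ys ! 0 = A ! 0" using Ane by (auto simp: xs ys_def nth_append)
  have dS: "distinct_nodes S"
    using ctxt_distinct[OF Suc.prems(3,1)] .
  have dS': "distinct_nodes S'" and nS': "nodes S = nodes S'"
    using dS spine_rearrange[OF ms, of E] by (auto simp: S S'_def)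
  have T': "top_node (C S) = top_node (C S')" "distinct_nodes (C S')" "nodes (C S') = V"
    using ctxt_replace[OF Suc.prems(3) rtS nS' dS' Suc.prems(1)] Suc.prems(2) by auto
  obtain Z where Z: "branchings (C S) = Z \<union> branchings S" "branchings (C S') = Z \<union> branchings S'"
    "\<forall>(a, b, c) \<in> Z. a \<notin> nodes S \<and> (b \<in> nodes S \<longrightarrow> b = top_node S) \<and> (c \<in> nodes S \<longrightarrow> c = top_node S)"
    using ctxt_branchings[OF Suc.prems(3) rtS Suc.prems(1)] by blast
  define F where "F = spine D E"
  have bS: "branchings S = spine_branchings A (fst (hd B)) \<union> spine_branchings B (fst y) \<union> spine_branchings [y] (top_node F) \<union> branchings F"
    using Ane by (auto simp: S xs spine_append branchings_spine top_node_spine F_def)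
  have bS': "branchings S' = spine_branchings A (fst y) \<union> spine_branchings [y] (fst (hd B)) \<union> spine_branchings B (top_node F) \<union> branchings F"
    using Ane by (auto simp: S'_def ys_def spine_append branchings_spine top_node_spine F_def)
  \<comment> \<open>Only the three vertices in front of a cut get a new left child.\<close>
  have change: "(a, b, c) \<in> branchings (C S') \<or> a \<in> {fst (last A), fst (last B), fst y}"
    if "(a, b, c) \<in> branchings (C S)" for a b c
    using that unfolding Z(1,2) bS bS'
    using spine_branchings_change_end[of a b c A _ "fst y"] spine_branchings_change_end[of a b c B _ "top_node F"]
      spine_branchings_change_end[of a b c "[y]" _ "fst (hd B)"]
    by (auto simp del: spine_branchings.simps)
  have parents: "fst ` branchings (C S) = fst ` branchings (C S')"
    unfolding Z(1,2) bS bS' image_Un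
      spine_branchings_parents[of A "fst (hd B)" "fst y"] spine_branchings_parents[of B "fst y" "top_node F"]
      spine_branchings_parents[of "[y]" "fst (hd B)" "top_node F"]
    by (simp only: Un_ac)
  \<comment> \<open>The constant outside \<open>S\<close> equals the value at the top of
    \<open>S\<close>, the only point where the outside touches \<open>S\<close>; hence
    \<open>f\<close> stays 1-Lipschitz.\<close>
  define f where "f v = (if v \<in> nodes S then int (spine_index xs v) else 0)" for v
  have f_nth: "f (fst (xs ! j)) = int j" if "j < length xs" for j
  proof -
    have "fst (xs ! j) \<in> nodes S" using nth_mem[OF that] by (auto simp: S nodes_spine item_nodes_def)
    then show ?thesis using spine_index_nth[of xs E j] dS that by (simp add: f_def S)
  qed
  have f_rt: "f (top_node S) = 0" by (simp add: f_def S spine_index_top_node)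
  have f_bad: "f a \<in> {int t + 2, 3 * int t + 6, 3 * int t + 7}"
    if "a \<in> {fst (last A), fst (last B), fst y}" for a
  proof -
    have "last A = xs ! (t + 2)" "last B = xs ! (3 * t + 6)"
      using Ane len by (auto simp: last_conv_nth xs nth_append)
    then show ?thesis using that f_nth[of "t + 2"] f_nth[of "3 * t + 6"] f_nth[of "3 * t + 7"] S(2)
      by (auto simp: y_def)
  qed
  have lip: "\<bar>f a - f b\<bar> \<le> 1 \<and> \<bar>f a - f c\<bar> \<le> 1" if "(a, b, c) \<in> branchings (C S)" for a b c
  proof (cases "(a, b, c) \<in> branchings S")
    case True
    then show ?thesis using spine_index_lipschitz[of xs E a b c] dS branchings_nodes[OF True] by (simp add: f_def S)
  next
    case False
    then have "a \<notin> nodes S" "b \<in> nodes S \<longrightarrow> b = top_node S" "c \<in> nodes S \<longrightarrow> c = top_node S"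
      using that Z by auto
    then have "f a = 0" "f b = 0" "f c = 0" using f_rt by (auto simp: f_def)
    then show ?thesis by simp
  qed
  \<comment> \<open>The changed triples have their parents at indices \<open>t + 2\<close>,
    \<open>3 * t + 6\<close> and \<open>3 * t + 7\<close>, at least \<open>t + 2\<close> away from
    both 0 and \<open>2 * t + 4\<close>. A triple meeting the window of radius \<open>t\<close> has
    its parent within \<open>t + 1\<close>.\<close>
  have same: "lab (C S) v = lab (C S') v" if v: "v \<in> nodes S" and fv: "f v = 0 \<or> f v = 2 * int t + 4" for v
  proof (rule lab_local[where f = f])
    fix a b c x assume triple: "(a, b, c) \<in> branchings (C S)" "x \<in> {a, b, c}" "\<bar>f x - f v\<bar> \<le> int t"
    then have "\<bar>f a - f v\<bar> \<le> int t + 1" using lip[OF triple(1)] by auto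
    then have "a \<notin> {fst (last A), fst (last B), fst y}" using f_bad[of a] fv by auto
    then show "(a, b, c) \<in> branchings (C S')" using change[OF triple(1)] by blast
  qed (use Suc.prems T' parents lip v ctxt_nodes[OF Suc.prems(3), of S] in auto)
  show ?case
  proof
    assume "lab (C S) (top_node S) \<in> level_set (Suc i)"
    have p0: "top_node S = fst (xs ! 0)" using Ane by (auto simp: S top_node_spine xs hd_conv_nth nth_append)
    let ?l = "lab (C (spine xs E))" and ?l' = "lab (C (spine ys E))"
    have T: "distinct_nodes (C (spine xs E))" "nodes (C (spine xs E)) = V"
      and T'': "distinct_nodes (C (spine ys E))" "nodes (C (spine ys E)) = V"
      using Suc.prems T' by (auto simp: S S'_def)
    have hangs: "\<And>x. x \<in> set xs \<Longrightarrow> ?l (top_node (snd x)) \<notin> level_set i"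
      "\<And>x. x \<in> set ys \<Longrightarrow> ?l' (top_node (snd x)) \<notin> level_set i"
      using hang[OF refl T] hang[OF ms T''] by auto
    have "?l (fst (xs ! 0)) \<notin> below (Suc i)"
      using spine_not_below[OF T Suc.prems(3) hangs(1), of i 0] S(2) Suc.prems(5) by simp
    then have top: "?l (fst (xs ! 0)) \<in> {LabA (Suc i), LabB (Suc i)}"
      using \<open>lab (C S) (top_node S) \<in> level_set (Suc i)\<close> p0 by (auto simp: level_set_def S)
    have top': "?l' (fst (ys ! 0)) = ?l (fst (xs ! 0))"
      using same[of "top_node S"] f_rt p0 hd0 by (simp add: S S'_def)
    \<comment> \<open>The observed vertex lies in \<open>B\<close>, so its position changes from
      even to odd. Alternation then demands the opposite label, although neither its label nor that
      of the top has changed.\<close>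
    have far: "ys ! (2 * t + 5) = xs ! (2 * t + 4)"
      using len by (auto simp: xs ys_def nth_append)
    have far_in: "fst (xs ! (2 * t + 4)) \<in> nodes S"
      using nth_mem[of "2 * t + 4" xs] S(2) by (auto simp: S nodes_spine item_nodes_def)
    have "?l' (fst (xs ! (2 * t + 4))) = ?l (fst (xs ! (2 * t + 4)))"
      using same[OF far_in] f_nth[of "2 * t + 4"] S(2) by (simp add: S S'_def)
    moreover have "?l (fst (xs ! (2 * t + 4))) = ?l (fst (xs ! 0))"
      using spine_alternates[OF T Suc.prems(3) hangs(1) top, of "2 * t + 4"] S(2) Suc.prems(5) by simp
    moreover have "?l' (fst (ys ! (2 * t + 5))) = flip (?l' (fst (ys ! 0)))"
      using spine_alternates[OF T'' Suc.prems(3) hangs(2), of "2 * t + 5"] top top' S(2) Suc.prems(5)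
        mset_eq_length[OF ms] by simp
    ultimately show False using top top' far by auto
  qed
qed

lemma no_rich: "distinct_nodes T \<Longrightarrow> nodes T = V \<Longrightarrow> \<not> rich (3 * t + 8 + k) k T"
proof
  assume T: "distinct_nodes T" "nodes T = V" and "rich (3 * t + 8 + k) k T"
  then have "lab T (top_node T) \<notin> level_set k"
    using rich_not_level_set[of k "\<lambda>X. X" T] by (simp add: ctxt_hole)
  moreover have "lab T (top_node T) \<in> Sigma_k k" using lab_Sigma T by auto
  ultimately show False by (simp add: Sigma_k_def level_set_def)
qed

end


section \<open>Trees with prescribed node sets\<close>

lemma exists_tree: "finite V \<Longrightarrow> odd (card V) \<Longrightarrow> \<exists>T. nodes T = V \<and> distinct_nodes T"
proof (induction "card V" arbitrary: V rule: less_induct)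
  case less
  show ?case
  proof (cases "card V = 1")
    case True
    then obtain a where "V = {a}" by (auto simp: card_1_singleton_iff)
    then show ?thesis by (intro exI[of _ "Lf a"]) auto
  next
    case False
    then have "2 \<le> card V" using less.prems by (cases "card V") auto
    then obtain W where W: "W \<subseteq> V" "card W = 2" by (metis obtain_subset_with_card_n)
    then obtain a b where ab: "W = {a, b}" "a \<noteq> b" by (auto simp: card_2_iff)
    have "card (V - W) = card V - 2"
      using W less.prems(1) by (simp add: card_Diff_subset finite_subset[OF W(1)])
    then have "card (V - W) < card V" "odd (card (V - W))"
      using less.prems \<open>2 \<le> card V\<close> by auto
    then obtain T where "nodes T = V - W" "distinct_nodes T"
      using less.hyps[of "V - W"] less.prems(1) by auto
    \<comment> \<open>Nodes are added in pairs, a new top and a leaf beside the old tree, which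
      preserves parity.\<close>
    then show ?thesis using ab W by (intro exI[of _ "Nd a T (Lf b)"]) auto
  qed
qed

text \<open>Each item takes a block of \<open>r + 1\<close> nodes. For odd \<open>r\<close> the
  blocks are even, so an odd, hence nonempty, remainder is left for \<open>E\<close>.\<close>

lemma exists_spine:
  assumes hang: "\<And>W. finite W \<Longrightarrow> card W = r \<Longrightarrow> \<exists>T. nodes T = W \<and> distinct_nodes T \<and> P T"
    and "odd r"
  shows "finite V \<Longrightarrow> odd (card V) \<Longrightarrow> m * (r + 1) < card V \<Longrightarrow>
    \<exists>xs E. nodes (spine xs E) = V \<and> distinct_nodes (spine xs E) \<and> length xs = m \<and> (\<forall>x \<in> set xs. P (snd x))"
proof (induction m arbitrary: V)
  case 0
  then show ?case using exists_tree[of V] by (metis empty_iff list.set(1) list.size(3) spine.simps(1))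
next
  case (Suc m)
  have big: "r + 1 < card V" "m * (r + 1) < card V - (r + 1)" using Suc.prems(3) by simp_all
  then obtain W where W: "W \<subseteq> V" "card W = r + 1"
    by (metis less_imp_le obtain_subset_with_card_n)
  have finW: "finite W" using W(1) Suc.prems(1) by (rule finite_subset)
  obtain a where a: "a \<in> W" using W(2) by fastforce
  obtain H where H: "nodes H = W - {a}" "distinct_nodes H" "P H"
    using hang[of "W - {a}"] finW a W(2) by auto
  have "card (V - W) = card V - (r + 1)"
    using W finW by (simp add: card_Diff_subset)
  then obtain xs E where "nodes (spine xs E) = V - W" "distinct_nodes (spine xs E)" "length xs = m"
    "\<forall>x \<in> set xs. P (snd x)"
    using Suc.IH[of "V - W"] Suc.prems big \<open>odd r\<close> by auto
  then show ?case
    using H a W by (intro exI[of _ "(a, H) # xs"] exI[of _ E]) auto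
qed

text \<open>Powers of \<open>2 * L + 1\<close> are odd, as the hanging trees require, and the factor
  2 pays for the spine vertices themselves.\<close>

lemma exists_rich:
  "finite V \<Longrightarrow> odd (card V) \<Longrightarrow> (2 * L + 1) ^ i \<le> card V \<Longrightarrow>
    \<exists>T. nodes T = V \<and> distinct_nodes T \<and> rich L i T"
proof (induction i arbitrary: V)
  case 0
  then show ?case using exists_tree[of V] by simp
next
  case (Suc i)
  let ?r = "(2 * L + 1) ^ i"
  have "L * (?r + 1) < (2 * L + 1) * ?r"
  proof -
    have "L * 1 \<le> L * ?r" "1 \<le> ?r" by (intro mult_le_mono2) simp_all
    moreover have "L * (?r + 1) = L * ?r + L" "(2 * L + 1) * ?r = 2 * (L * ?r) + ?r"
      by (simp_all add: distrib_right)
    ultimately show ?thesis by linarith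
  qed
  then have "L * (?r + 1) < card V" using Suc.prems(3) by simp
  moreover have "odd ?r" by simp
  ultimately obtain xs E where "nodes (spine xs E) = V" "distinct_nodes (spine xs E)" "length xs = L"
    "\<forall>x \<in> set xs. rich L i (snd x)"
    using exists_spine[of ?r "rich L i" V L] Suc by (metis order_refl)
  then show ?case by (metis rich.simps(2))
qed

section \<open>From distributed algorithms to local labellings\<close>

lemma local_lower_bound:
  assumes sol: "solves c (Pi_k k) A" and k: "k \<ge> 1" and c: "c \<ge> 1" and n: "odd n"
    and time: "worst_case_time c (Pi_k k) A n \<le> enat t"
  shows "n < (2 * (3 * t + 8 + k) + 1) ^ k"
proof (rule ccontr)
  assume "\<not> n < (2 * (3 * t + 8 + k) + 1) ^ k"
  then obtain T where T: "nodes T = {1..n}" "distinct_nodes T" "rich (3 * t + 8 + k) k T"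
    using exists_rich[of "{1..n}" "3 * t + 8 + k" k] n by auto
  have net: "net S \<in> networks c 2 n" if "distinct_nodes S" "nodes S = {1..n}" for S
    using that c by (rule net_in_networks)
  have ar: "arity (Pi_k k) = 2" by (simp add: Pi_k_def)
  have dec: "\<exists>s \<le> t. decision A (net S) s v \<noteq> None"
    if S: "distinct_nodes S" "nodes S = {1..n}" and v: "v \<in> {1..n}" for S v
  proof -
    have "running_time A (net S) \<le> enat t"
      using time net[OF S] unfolding worst_case_time_def ar by (meson SUP_upper order_trans)
    \<comment> \<open>Passing to the strict bound \<open>Suc t\<close> makes some element of the
      set, an actual number of rounds, available.\<close>
    then have "Inf {enat t | t. \<forall>v \<in> verts (net S). \<exists>s \<le> t. decision A (net S) s v \<noteq> None} < enat (Suc t)"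
      unfolding running_time_def by (simp add: order_le_less_trans)
    then obtain t' where t': "enat t' < enat (Suc t)" "\<forall>v \<in> verts (net S). \<exists>s \<le> t'. decision A (net S) s v \<noteq> None"
      unfolding Inf_less_iff by auto
    moreover have "v \<in> verts (net S)" using v S by (simp add: net_def)
    ultimately obtain s where "s \<le> t'" "decision A (net S) s v \<noteq> None" using t'(2) by blast
    moreover have "t' \<le> t" using t'(1) by simp
    ultimately show ?thesis by (meson order_trans)
  qed
  interpret local_labelling "\<lambda>S. output_label A (net S)" "{1..n}" k t
  proof
    fix S assume S: "distinct_nodes S" "nodes S = {1..n}"
    have is_sol: "is_solution (Pi_k k) (net S) (output_label A (net S))"
      using sol net[OF S] unfolding solves_def ar by blast
    show "output_label A (net S) v \<in> Sigma_k k" if "v \<in> {1..n}" for v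
      using is_sol that S by (auto simp: is_solution_def net_def Pi_k_def)
    fix a b c assume triple: "(a, b, c) \<in> branchings S"
    have ch: "children (net S) a = {b, c}" "b \<noteq> c"
      using S triple by (auto simp: children_net child_list_branch dest: branchings_distinct)
    then have "card (children (net S) a) = arity (Pi_k k)" by (simp add: ar)
    moreover have "a \<in> verts (net S)" using branchings_nodes[OF triple] by (simp add: net_def)
    ultimately obtain ws where ws: "distinct ws" "set ws = {b, c}"
      "(output_label A (net S) a, map (output_label A (net S)) ws) \<in> configs (Pi_k k)"
      using is_sol ch unfolding is_solution_def by metis
    have "length ws = 2" using distinct_card[OF ws(1)] ws(2) ch(2) by simp
    then obtain x y where "ws = [x, y]" by (auto simp: length_Suc_conv numeral_2_eq_2)
    then have "ws = [b, c] \<or> ws = [c, b]" using ws(2) by (auto simp: doubleton_eq_iff)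
    then show "allowed k (output_label A (net S) a) (output_label A (net S) b) (output_label A (net S) c)"
      using ws(3) by (auto simp: allowed_def)
  next
    fix f :: "nat \<Rightarrow> int" and S S' v
    assume S: "distinct_nodes S" "distinct_nodes S'" "nodes S = {1..n}" "nodes S' = {1..n}" "top_node S = top_node S'"
      "fst ` branchings S = fst ` branchings S'"
      "\<And>a b c. (a, b, c) \<in> branchings S \<Longrightarrow> \<bar>f a - f b\<bar> \<le> 1 \<and> \<bar>f a - f c\<bar> \<le> 1"
      "\<And>a b c x. (a, b, c) \<in> branchings S \<Longrightarrow> x \<in> {a, b, c} \<Longrightarrow> \<bar>f x - f v\<bar> \<le> int t \<Longrightarrow> (a, b, c) \<in> branchings S'"
      "v \<in> {1..n}"
    from dec[OF S(1,3,9)] obtain s where s: "s \<le> t" "decision A (net S) s v \<noteq> None" by blast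
    show "output_label A (net S) v = output_label A (net S') v"
      by (rule net_output_agree[where f = f and t = t and s = s]) (use S s in blast)+
  qed (rule k)
  show False using no_rich T by simp
qed

section \<open>Peeling a full binary tree\<close>

text \<open>Take the distance to the root: parents are unique, so a shortest path from a non-root
  vertex starts with the step to its parent.\<close>

lemma rooted_tree_depth:
  assumes "is_rooted_tree T"
  shows "\<exists>d :: nat \<Rightarrow> nat. \<forall>v \<in> verts T. \<forall>u. parent T v = Some u \<longrightarrow> d u < d v"
proof -
  let ?R = "{(w, u). w \<in> verts T \<and> parent T w = Some u}"
  define d where "d v = (LEAST m. (v, root_node T) \<in> ?R ^^ m)" for v
  have "d u < d v" if v: "v \<in> verts T" and u: "parent T v = Some u" for u v
  proof -
    have "(v, root_node T) \<in> ?R\<^sup>*" using assms v by (simp add: is_rooted_tree_def)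
    then obtain m where "(v, root_node T) \<in> ?R ^^ m" unfolding rtrancl_power by blast
    then have dv: "(v, root_node T) \<in> ?R ^^ d v"
      unfolding d_def by (rule LeastI[where P = "\<lambda>m. (v, root_node T) \<in> ?R ^^ m"])
    have "v \<noteq> root_node T" using assms u by (auto simp: is_rooted_tree_def)
    have "d v \<noteq> 0"
    proof
      assume "d v = 0"
      with dv have "v = root_node T" by simp
      with \<open>v \<noteq> root_node T\<close> show False ..
    qed
    then obtain m' where m': "d v = Suc m'" by (cases "d v") auto
    have "(v, root_node T) \<in> ?R ^^ Suc m'" using dv unfolding m' .
    then obtain w where "(v, w) \<in> ?R" "(w, root_node T) \<in> ?R ^^ m'"
      by (blast dest: relpow_Suc_D2)
    then have "(u, root_node T) \<in> ?R ^^ m'" using u by simp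
    then have "d u \<le> m'"
      unfolding d_def by (rule Least_le[where P = "\<lambda>m. (u, root_node T) \<in> ?R ^^ m"])
    then show ?thesis using m' by simp
  qed
  then show ?thesis by blast
qed

locale peeling =
  fixes N :: network and k s :: nat
  assumes full: "is_full_tree 2 N" and k: "k \<ge> 1" and s: "s \<ge> 1" and few: "card (verts N) < s ^ k"
begin

text \<open>Time is cut into \<open>k\<close> phases of \<open>s + 1\<close> rounds. A vertex is normally peeled one round after its
  last child, but in the last round of a phase after its first child.\<close>

primrec peeled :: "nat \<Rightarrow> nat set" where
  "peeled 0 = {}"
| "peeled (Suc t) = peeled t \<union> {v \<in> verts N. if Suc s dvd Suc t
     then \<exists>w \<in> children N v. w \<in> peeled t else \<forall>w \<in> children N v. w \<in> peeled t}"

lemma fin: "finite (verts N)" and tree: "is_rooted_tree N"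
  using full by (auto simp: is_full_tree_def is_rooted_tree_def)

lemma finite_children [simp]: "finite (children N v)"
  using fin by (auto simp: children_def)

lemma children_subset: "children N v \<subseteq> verts N"
  by (auto simp: children_def)

lemma parent_in_verts: "v \<in> verts N \<Longrightarrow> parent N v = Some u \<Longrightarrow> u \<in> verts N"
proof -
  assume v: "v \<in> verts N" and u: "parent N v = Some u"
  have "v \<noteq> root_node N" using tree u by (auto simp: is_rooted_tree_def)
  then obtain u' where "u' \<in> verts N" "parent N v = Some u'"
    using tree v unfolding is_rooted_tree_def by blast
  then show "u \<in> verts N" using u by simp
qed

lemma peeled_mono: "t \<le> t' \<Longrightarrow> peeled t \<subseteq> peeled t'"
  by (rule lift_Suc_mono_le[of peeled]) auto

text \<open>Rounds are counted from 0, so the last round of a phase has offset \<open>s\<close> and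
  all smaller offsets are ordinary rounds.\<close>

lemma not_dvd: "j < s \<Longrightarrow> \<not> Suc s dvd Suc (i * Suc s + j)"
proof
  assume "j < s" "Suc s dvd Suc (i * Suc s + j)"
  then have "Suc s dvd Suc j" by (metis add_Suc_right dvd_add_right_iff dvd_triv_right)
  then show False using \<open>j < s\<close> by (auto dest: dvd_imp_le)
qed

text \<open>A charging argument. \<open>\<phi> v\<close> counts the times \<open>j < s\<close> of
  the phase at which \<open>v\<close> is still unpeeled. Both children of a survivor wait for all of
  them, which leaves a surplus of \<open>s\<close>; any other vertex exceeds the sum of its children
  by at most 1, and only if it entered the phase unpeeled. In the sum over the tree each
  \<open>\<phi> w\<close> is used by at most one parent and cancels.\<close>

lemma peel_count: "s * card (verts N - peeled (i * Suc s + Suc s)) \<le> card (verts N - peeled (i * Suc s))"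
proof -
  let ?V = "verts N" and ?b = "i * Suc s"
  define J where "J v = {j. j < s \<and> v \<notin> peeled (?b + j)}" for v
  define \<phi> where "\<phi> v = card (J v)" for v
  have finJ: "finite (J v)" for v by (simp add: J_def)
  have le_s: "\<phi> v \<le> s" for v
    unfolding \<phi>_def J_def by (rule order_trans[OF card_mono[of "{..<s}"]]) auto
  have loc: "\<phi> v + s * of_bool (v \<notin> peeled (?b + Suc s)) \<le> (\<Sum>w\<in>children N v. \<phi> w) + of_bool (v \<notin> peeled ?b)"
    if v: "v \<in> ?V" for v
  proof (cases "v \<in> peeled (?b + Suc s)")
    case True
    show ?thesis
    proof (cases "v \<in> peeled ?b")
      case True
      then have "v \<in> peeled (?b + j)" for j using peeled_mono[of ?b "?b + j"] by auto
      then have "J v = {}" by (auto simp: J_def)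
      then show ?thesis using \<open>v \<in> peeled (?b + Suc s)\<close> by (simp add: \<phi>_def)
    next
      case False
      \<comment> \<open>In an ordinary round \<open>v\<close> keeps waiting only because of a child
        that was still waiting one step earlier.\<close>
      have "J v \<subseteq> insert 0 (Suc ` (\<Union>w\<in>children N v. J w))"
      proof
        fix j assume j: "j \<in> J v"
        show "j \<in> insert 0 (Suc ` (\<Union>w\<in>children N v. J w))"
        proof (cases j)
          case (Suc j')
          then have "\<not> (\<forall>w \<in> children N v. w \<in> peeled (?b + j'))"
            using j v not_dvd[of j' i] by (auto simp: J_def)
          then obtain w where "w \<in> children N v" "w \<notin> peeled (?b + j')" by blast
          moreover have "j' < s" using Suc j by (simp add: J_def)
          ultimately have "j' \<in> J w" by (simp add: J_def)
          then show ?thesis using Suc \<open>w \<in> children N v\<close> by blast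
        qed simp
      qed
      then have "\<phi> v \<le> card (insert 0 (Suc ` (\<Union>w\<in>children N v. J w)))"
        unfolding \<phi>_def by (rule card_mono[rotated]) (simp add: finJ)
      also have "\<dots> \<le> Suc (card (\<Union>w\<in>children N v. J w))"
        by (simp add: card_insert_if card_image finJ)
      also have "\<dots> \<le> Suc (\<Sum>w\<in>children N v. \<phi> w)"
        unfolding \<phi>_def by (simp add: card_UN_le)
      finally show ?thesis using True False by simp
    qed
  next
    case False
    \<comment> \<open>A leaf satisfies the condition of an ordinary round vacuously and leaves in
      the first one, so a survivor is a branching vertex.\<close>
    have "Suc (?b + 0) \<le> ?b + Suc s" by simp
    then have "v \<notin> peeled (Suc (?b + 0))" using False peeled_mono by blast
    then have "children N v \<noteq> {}" using v not_dvd[of 0 i] s by auto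
    then have "card (children N v) = 2"
      using full v by (auto simp: is_full_tree_def)
    moreover have "\<phi> w = s" if "w \<in> children N v" for w
    proof -
      \<comment> \<open>A child peeled before the last round of the phase would have taken
        \<open>v\<close> along in that round.\<close>
      have "Suc s dvd Suc (?b + s)" by (metis add_Suc_right dvd_add_triv_right_iff dvd_triv_right)
      then have "w \<notin> peeled (?b + s)" using False that v by auto
      then have "w \<notin> peeled (?b + j)" if "j < s" for j
        using peeled_mono[of "?b + j" "?b + s"] add_left_mono[OF less_imp_le[OF that], of ?b] by blast
      then have "J w = {..<s}" by (auto simp: J_def)
      then show ?thesis by (simp add: \<phi>_def)
    qed
    ultimately have "(\<Sum>w\<in>children N v. \<phi> w) = 2 * s" by simp
    then show ?thesis using le_s[of v] False by simp
  qed
  have "(\<Sum>v\<in>?V. \<Sum>w\<in>children N v. \<phi> w) = (\<Sum>w\<in>(\<Union>v\<in>?V. children N v). \<phi> w)"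
    by (rule sum.UNION_disjoint[symmetric]) (auto simp: fin, auto simp: children_def)
  also have "\<dots> \<le> (\<Sum>v\<in>?V. \<phi> v)"
    by (rule sum_mono2) (use children_subset fin in auto)
  finally have tele: "(\<Sum>v\<in>?V. \<Sum>w\<in>children N v. \<phi> w) \<le> (\<Sum>v\<in>?V. \<phi> v)" .
  have cnt: "(\<Sum>v\<in>?V. of_bool (v \<notin> X)) = card (?V - X)" for X
    using fin by (simp add: Collect_conj_eq Diff_eq Compl_eq)
  have "(\<Sum>v\<in>?V. \<phi> v + s * of_bool (v \<notin> peeled (?b + Suc s))) \<le>
      (\<Sum>v\<in>?V. (\<Sum>w\<in>children N v. \<phi> w) + of_bool (v \<notin> peeled ?b))"
    by (rule sum_mono) (rule loc)
  then have "(\<Sum>v\<in>?V. \<phi> v) + s * card (?V - peeled (?b + Suc s)) \<le>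
      (\<Sum>v\<in>?V. \<Sum>w\<in>children N v. \<phi> w) + card (?V - peeled ?b)"
    by (simp only: sum.distrib cnt flip: sum_distrib_left)
  with tele show ?thesis by simp
qed

lemma peel_count_power: "s ^ i * card (verts N - peeled (i * Suc s)) \<le> card (verts N)"
proof (induction i)
  case (Suc i)
  have "s ^ Suc i * card (verts N - peeled (Suc i * Suc s)) =
      s ^ i * (s * card (verts N - peeled (i * Suc s + Suc s)))"
  proof -
    have "Suc i * Suc s = i * Suc s + Suc s" by simp
    then show ?thesis by (simp only: power_Suc mult_ac)
  qed
  also have "\<dots> \<le> s ^ i * card (verts N - peeled (i * Suc s))"
    by (rule mult_le_mono2[OF peel_count])
  finally show ?case using Suc.IH by (rule order_trans)
qed simp

text \<open>A deepest unpeeled vertex has no unpeeled child, so every ordinary round removes at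
  least one vertex. This slow rate suffices for the last phase.\<close>

lemma peel_progress:
  "j \<le> s \<Longrightarrow> verts N \<subseteq> peeled (i * Suc s + j) \<or>
     card (verts N - peeled (i * Suc s + j)) + j \<le> card (verts N - peeled (i * Suc s))"
proof (induction j)
  case (Suc j)
  let ?X = "verts N - peeled (i * Suc s + j)" and ?Y = "verts N - peeled (i * Suc s + Suc j)"
  have sub: "?Y \<subseteq> ?X" using peeled_mono[of "i * Suc s + j" "i * Suc s + Suc j"] by auto
  show ?case
  proof (cases "?X = {}")
    case True
    then show ?thesis using sub by auto
  next
    case False
    obtain d :: "nat \<Rightarrow> nat" where d: "\<And>v u. v \<in> verts N \<Longrightarrow> parent N v = Some u \<Longrightarrow> d u < d v"
      using rooted_tree_depth[OF tree] by blast
    have finX: "finite ?X" using fin by simp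
    have "Max (d ` ?X) \<in> d ` ?X" using finX False by (intro Max_in) auto
    then obtain v where v: "v \<in> ?X" "d v = Max (d ` ?X)" by auto
    have max: "d w \<le> d v" if "w \<in> ?X" for w
      unfolding v(2) using finX that by (intro Max_ge) auto
    have "w \<in> peeled (i * Suc s + j)" if "w \<in> children N v" for w
      using that max[of w] d[of w v] by (force simp: children_def)
    then have "v \<notin> ?Y" using v(1) not_dvd[of j i] Suc.prems by auto
    then have "card ?Y < card ?X" using sub v(1) finX by (intro psubset_card_mono) auto
    moreover have "card ?X + j \<le> card (verts N - peeled (i * Suc s))"
      using Suc False by auto
    ultimately show ?thesis by simp
  qed
qed simp

text \<open>By \<open>peel_count_power\<close> fewer than \<open>s\<close> vertices enter the last
  phase, so its \<open>s\<close> ordinary rounds remove them all. Its cutting round is never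
  reached, so no label \<open>LabX k\<close> is ever called for.\<close>

lemma all_peeled: "verts N \<subseteq> peeled ((k - 1) * Suc s + s)"
proof (rule ccontr)
  assume "\<not> ?thesis"
  then have "s \<le> card (verts N - peeled ((k - 1) * Suc s))"
    using peel_progress[of s "k - 1"] by auto
  then have "s ^ (k - 1) * s \<le> s ^ (k - 1) * card (verts N - peeled ((k - 1) * Suc s))"
    by (rule mult_le_mono2)
  also have "\<dots> \<le> card (verts N)" by (rule peel_count_power)
  finally show False using few k by (simp add: power_eq_if mult.commute)
qed

section \<open>Rounds, phases and components of single vertices\<close>

definition round_of :: "nat \<Rightarrow> nat" where
  "round_of v = (LEAST t. v \<in> peeled (Suc t))"

lemma peeled_iff: assumes "v \<in> verts N" shows "v \<in> peeled t \<longleftrightarrow> round_of v < t"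
proof -
  have "v \<in> peeled ((k - 1) * Suc s + s)" using all_peeled assms by blast
  moreover have "(k - 1) * Suc s + s = Suc ((k - 1) * Suc s + s - 1)" using s by simp
  ultimately have "v \<in> peeled (Suc ((k - 1) * Suc s + s - 1))" by simp
  then have m: "v \<in> peeled (Suc (round_of v))" unfolding round_of_def by (rule LeastI)
  show ?thesis
  proof
    assume t: "v \<in> peeled t"
    then obtain t' where "t = Suc t'" by (cases t) auto
    then show "round_of v < t" using t by (auto simp: round_of_def less_Suc_eq_le intro: Least_le)
  next
    assume "round_of v < t"
    then show "v \<in> peeled t" using m peeled_mono[of "Suc (round_of v)" t] by auto
  qed
qed

lemma round_bound: "v \<in> verts N \<Longrightarrow> round_of v < (k - 1) * Suc s + s"
  using peeled_iff all_peeled by blast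

lemma round_step:
  assumes "v \<in> verts N"
  shows "if Suc s dvd Suc (round_of v) then \<exists>w \<in> children N v. round_of w < round_of v
    else \<forall>w \<in> children N v. round_of w < round_of v"
proof -
  have "v \<in> peeled (Suc (round_of v))" "v \<notin> peeled (round_of v)"
    unfolding peeled_iff[OF assms] by simp_all
  then have "if Suc s dvd Suc (round_of v) then \<exists>w \<in> children N v. w \<in> peeled (round_of v)
    else \<forall>w \<in> children N v. w \<in> peeled (round_of v)" by simp
  moreover have "w \<in> peeled t \<longleftrightarrow> round_of w < t" if "w \<in> children N v" for w t
    using peeled_iff children_subset that by blast
  ultimately show ?thesis by (auto split: if_splits)
qed

definition phase :: "nat \<Rightarrow> nat" where
  "phase v = round_of v div Suc s"

definition cut :: "nat \<Rightarrow> bool" where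
  "cut v \<longleftrightarrow> Suc s dvd Suc (round_of v)"

text \<open>The parent belongs to the same phase without being cut, that is, to the same a/b
  component. The form with two points in time is what a vertex can read off the messages of its
  parent.\<close>

definition linked :: "nat \<Rightarrow> bool" where
  "linked v \<longleftrightarrow> (\<exists>u. parent N v = Some u \<and> u \<notin> peeled (phase v * Suc s) \<and> u \<in> peeled (phase v * Suc s + s))"

text \<open>Linked vertices alternate colours with their parents; iterating this from the constant colouring
  propagates the right colours downwards from the tops of the components.\<close>

primrec colour :: "nat \<Rightarrow> nat \<Rightarrow> bool" where
  "colour 0 v = True"
| "colour (Suc j) v = (linked v \<longrightarrow> \<not> colour j (the (parent N v)))"

lemma round_phase: "phase v * Suc s \<le> round_of v" "round_of v \<le> phase v * Suc s + s"
proof -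
  have "round_of v = phase v * Suc s + round_of v mod Suc s"
    unfolding phase_def by (simp only: div_mult_mod_eq)
  moreover have "round_of v mod Suc s \<le> s" using mod_less_divisor[of "Suc s" "round_of v"] by simp
  ultimately show "phase v * Suc s \<le> round_of v" "round_of v \<le> phase v * Suc s + s" by linarith+
qed

lemma phase_eqI: "q * Suc s \<le> round_of v \<Longrightarrow> round_of v \<le> q * Suc s + s \<Longrightarrow> phase v = q"
  unfolding phase_def by (rule div_nat_eqI) (simp_all add: mult.commute)

lemma cut_iff: "cut v \<longleftrightarrow> round_of v = phase v * Suc s + s"
proof
  assume "cut v"
  moreover obtain j where j: "round_of v = phase v * Suc s + j"
    using round_phase(1)[of v] le_Suc_ex by blast
  ultimately have "\<not> j < s" using not_dvd[of j "phase v"] by (metis cut_def)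
  then show "round_of v = phase v * Suc s + s" using j round_phase(2)[of v] by linarith
next
  assume "round_of v = phase v * Suc s + s"
  then have "Suc (round_of v) = phase v * Suc s + Suc s" by simp
  then show "cut v" unfolding cut_def by (metis dvd_add dvd_triv_right dvd_refl)
qed

lemma linked_parent:
  assumes v: "v \<in> verts N" and l: "linked v"
  obtains u where "parent N v = Some u" "u \<in> verts N" "phase u = phase v" "\<not> cut u" "round_of v < round_of u"
proof -
  obtain u where u: "parent N v = Some u" "u \<notin> peeled (phase v * Suc s)" "u \<in> peeled (phase v * Suc s + s)"
    using l by (auto simp: linked_def)
  have uV: "u \<in> verts N" using parent_in_verts v u(1) by blast
  have r: "phase v * Suc s \<le> round_of u" "round_of u < phase v * Suc s + s"
    using u peeled_iff[OF uV] by auto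
  then have ph: "phase u = phase v" by (intro phase_eqI) auto
  then have c: "\<not> cut u" using r by (simp add: cut_iff)
  have "v \<in> children N u" using v u(1) by (simp add: children_def)
  then have "round_of v < round_of u" using round_step[OF uV] c by (auto simp: cut_def)
  then show ?thesis using that u(1) uV ph c by blast
qed

text \<open>The round strictly increases from a vertex to its linked parent and stays below the last
  round of the phase. So the distance to the top of the component is bounded by the rounds left in
  the phase, and after that many iterations the colour is final.\<close>

lemma colour_stable:
  "v \<in> verts N \<Longrightarrow> \<not> cut v \<Longrightarrow> phase v * Suc s + s \<le> j + round_of v \<Longrightarrow> colour (Suc j) v = colour j v"
proof (induction j arbitrary: v)
  case 0
  then have "round_of v = phase v * Suc s + s" using round_phase(2)[of v] by simp
  then show ?case using 0 by (simp add: cut_iff)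
next
  case (Suc j)
  show ?case
  proof (cases "linked v")
    case True
    then obtain u where u: "parent N v = Some u" "u \<in> verts N" "phase u = phase v" "\<not> cut u" "round_of v < round_of u"
      using linked_parent Suc.prems(1) by blast
    then have "colour (Suc j) u = colour j u" using Suc.IH[of u] Suc.prems by simp
    then show ?thesis using True u(1) by simp
  qed simp
qed

section \<open>The labelling read off from the peeling\<close>

definition final_label :: "nat \<Rightarrow> label" where
  "final_label v = (if cut v then LabX (Suc (phase v))
     else if colour (Suc s) v then LabA (Suc (phase v)) else LabB (Suc (phase v)))"

lemma final_label_cases:
  "final_label v = LabX (Suc (phase v)) \<and> cut v \<or>
   final_label v \<in> {LabA (Suc (phase v)), LabB (Suc (phase v))} \<and> \<not> cut v"
  by (simp add: final_label_def)

lemma phase_less: assumes "v \<in> verts N" shows "phase v < k" "cut v \<Longrightarrow> Suc (phase v) < k"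
proof -
  have less: "phase v * Suc s < (k - 1) * Suc s + s"
    using round_bound[OF assms] round_phase(1)[of v] by simp
  also have "\<dots> < k * Suc s" using k by (cases k) auto
  finally show "phase v < k" by (simp only: mult_less_cancel2)
  assume "cut v"
  then have "phase v * Suc s < (k - 1) * Suc s"
    using round_bound[OF assms] by (simp add: cut_iff)
  then have "phase v < k - 1" by (simp only: mult_less_cancel2)
  then show "Suc (phase v) < k" by simp
qed

lemma final_label_Sigma: "v \<in> verts N \<Longrightarrow> final_label v \<in> Sigma_k k"
  using final_label_cases[of v] phase_less[of v] by (force simp: Sigma_k_def below_iff)

lemma final_label_below: "phase w < i \<Longrightarrow> final_label w \<in> below (Suc i)"
  using final_label_cases[of w] by (auto simp: below_iff)

lemma phase_mono: "round_of w \<le> round_of v \<Longrightarrow> phase w \<le> phase v"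
  unfolding phase_def by (rule div_le_mono)

text \<open>A child peeled earlier has either an earlier phase, hence a lower level, or the same
  phase; in the latter case it cannot be cut, as the cutting round comes last.\<close>

lemma final_label_child:
  assumes w: "w \<in> children N v" and v: "v \<in> verts N" and less: "round_of w < round_of v"
  shows "final_label w \<in> level_set (Suc (phase v))"
    and "\<not> cut v \<Longrightarrow> phase w = phase v \<Longrightarrow> \<not> cut w \<and> colour (Suc s) w \<noteq> colour (Suc s) v"
proof -
  have nc: "\<not> cut w" if "phase w = phase v"
    using that less round_phase(2)[of v] by (simp add: cut_iff)
  show "final_label w \<in> level_set (Suc (phase v))"
  proof (cases "phase w = phase v")
    case True
    then show ?thesis using final_label_cases[of w] nc by (auto simp: level_set_def)
  next
    case False
    then have "phase w < phase v" using phase_mono[of w v] less by simp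
    then show ?thesis using final_label_below[of w "phase v"] by (simp add: level_set_def)
  qed
  assume c: "\<not> cut v" and ph: "phase w = phase v"
  have "round_of v < phase v * Suc s + s" using c round_phase(2)[of v] by (simp add: cut_iff)
  moreover have p: "parent N w = Some v" using w by (simp add: children_def)
  ultimately have "linked w"
    using ph round_phase(1)[of v] by (auto simp: linked_def peeled_iff[OF v])
  then have "colour (Suc s) w = (\<not> colour s v)" using p by simp
  \<comment> \<open>The child negates the previous colour of \<open>v\<close>, so stability after
    \<open>s\<close> iterations is what makes the two final colours opposite.\<close>
  moreover have "colour (Suc s) v = colour s v"
    using colour_stable[OF v c, of s] round_phase(1)[of v] by simp
  ultimately show "\<not> cut w \<and> colour (Suc s) w \<noteq> colour (Suc s) v" using nc ph by simp
qed

text \<open>At a cut vertex the child peeled before it serves as the restricted child of (iii). At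
  any other vertex both children are peeled before it.\<close>

lemma final_label_allowed:
  assumes v: "v \<in> verts N" and ch: "children N v = {a, b}"
  shows "allowed k (final_label v) (final_label a) (final_label b)"
proof (cases "cut v")
  case True
  then obtain w where w: "w \<in> {a, b}" "round_of w < round_of v"
    using round_step[OF v] ch by (auto simp: cut_def)
  then have "final_label w \<in> level_set (Suc (phase v))" using final_label_child(1) ch v by blast
  moreover have "final_label a \<in> Sigma_k k" "final_label b \<in> Sigma_k k"
    using final_label_Sigma children_subset[of v] ch by auto
  ultimately show ?thesis
    using w(1) True phase_less(2)[OF v True] by (auto simp: final_label_def allowed_X)
next
  case False
  have "final_label w \<in> below (Suc (phase v)) \<union>
      {if colour (Suc s) v then LabB (Suc (phase v)) else LabA (Suc (phase v))}" if "w \<in> {a, b}" for w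
  proof -
    have less: "round_of w < round_of v" using round_step[OF v] False ch that by (auto simp: cut_def)
    show ?thesis
    proof (cases "phase w = phase v")
      case True
      then show ?thesis
        using final_label_child(2)[of w v] ch that v less False by (auto simp: final_label_def)
    next
      case False
      then have "phase w < phase v" using phase_mono[of w v] less by simp
      then show ?thesis using final_label_below by blast
    qed
  qed
  from this[of a] this[of b] show ?thesis
    using False phase_less(1)[OF v]
    by (cases "colour (Suc s) v")
       (simp_all add: final_label_def[of v] allowed_A allowed_B del: colour.simps)
qed

lemma final_label_solution:
  assumes "\<And>v. v \<in> verts N \<Longrightarrow> lab v = final_label v"
  shows "is_solution (Pi_k k) N lab"
proof -
  have "\<exists>ws. distinct ws \<and> set ws = children N v \<and> (lab v, map lab ws) \<in> configs (Pi_k k)"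
    if v: "v \<in> verts N" and two: "card (children N v) = 2" for v
  proof -
    obtain a b where ab: "children N v = {a, b}" "a \<noteq> b" using two by (auto simp: card_2_iff)
    then have "lab a = final_label a" "lab b = final_label b" using assms children_subset[of v] by auto
    then have "(lab v, map lab [a, b]) \<in> configs (Pi_k k) \<or> (lab v, map lab [b, a]) \<in> configs (Pi_k k)"
      using final_label_allowed[OF v ab(1)] assms[OF v] by (simp add: allowed_def)
    then show ?thesis
    proof
      assume "(lab v, map lab [a, b]) \<in> configs (Pi_k k)"
      then show ?thesis using ab by (intro exI[of _ "[a, b]"]) simp
    next
      assume "(lab v, map lab [b, a]) \<in> configs (Pi_k k)"
      then show ?thesis using ab by (intro exI[of _ "[b, a]"]) auto
    qed
  qed
  then show ?thesis
    using assms final_label_Sigma by (auto simp: is_solution_def Pi_k_def)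
qed

end

section \<open>The peeling algorithm\<close>

text \<open>Strictly above the \<open>k\<close>-th root of \<open>n\<close>, as the counting
  argument needs, but by at most 1.\<close>

definition width :: "nat \<Rightarrow> nat \<Rightarrow> nat" where
  "width k n = Suc (nat \<lfloor>real n powr (1 / real k)\<rfloor>)"

definition child_ports :: "knowledge \<Rightarrow> nat set" where
  "child_ports K = {i. i < own_degree K \<and> parent_port K \<noteq> Some i}"

text \<open>The rule of \<open>peeled\<close> as a vertex sees it: \<open>m\<close> lists the
  messages of round \<open>t\<close>, and \<open>[True]\<close> from a child reports that the child
  is already peeled.\<close>

definition fires :: "nat \<Rightarrow> knowledge \<Rightarrow> nat \<Rightarrow> message list \<Rightarrow> bool" where
  "fires s K t m \<longleftrightarrow> (if Suc s dvd Suc t then \<exists>i \<in> child_ports K. m ! i = [True]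
     else \<forall>i \<in> child_ports K. m ! i = [True])"

definition seen_peeled :: "nat \<Rightarrow> knowledge \<Rightarrow> history \<Rightarrow> nat \<Rightarrow> bool" where
  "seen_peeled s K h t \<longleftrightarrow> (\<exists>r < t. fires s K r (h ! r))"

definition seen_round :: "nat \<Rightarrow> knowledge \<Rightarrow> history \<Rightarrow> nat" where
  "seen_round s K h = (LEAST r. fires s K r (h ! r))"

definition seen_linked :: "nat \<Rightarrow> knowledge \<Rightarrow> history \<Rightarrow> bool" where
  "seen_linked s K h \<longleftrightarrow> (let b = (seen_round s K h div Suc s) * Suc s in
     \<exists>p. parent_port K = Some p \<and> h ! b ! p \<noteq> [True] \<and> h ! (b + s) ! p = [True])"

text \<open>At the start of the colouring, when the history has length \<open>k * Suc s\<close>,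
  everyone has the default \<open>colour 0\<close>. Later the last message of the parent is the
  parent's previous colour.\<close>

definition seen_colour :: "nat \<Rightarrow> nat \<Rightarrow> knowledge \<Rightarrow> history \<Rightarrow> bool" where
  "seen_colour k s K h \<longleftrightarrow> (length h \<noteq> k * Suc s \<and> seen_linked s K h \<longrightarrow>
     last h ! the (parent_port K) \<noteq> [True])"

definition bit :: "nat \<Rightarrow> nat \<Rightarrow> knowledge \<Rightarrow> history \<Rightarrow> bool" where
  "bit k s K h = (if length h < k * Suc s then seen_peeled s K h (length h) else seen_colour k s K h)"

definition seen_label :: "nat \<Rightarrow> nat \<Rightarrow> knowledge \<Rightarrow> history \<Rightarrow> label" where
  "seen_label k s K h = (let r = seen_round s K h; i = Suc (r div Suc s) in
     if Suc s dvd Suc r then LabX i else if seen_colour k s K h then LabA i else LabB i)"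

text \<open>All vertices decide simultaneously, after \<open>k\<close> phases of
  \<open>s + 1\<close> peeling rounds and \<open>s + 1\<close> colouring rounds, with
  \<open>s\<close> the width.\<close>

definition peeling_algorithm :: "nat \<Rightarrow> label algorithm" where
  "peeling_algorithm k = \<lparr>
     send = (\<lambda>K h i. [bit k (width k (num_nodes K)) K h]),
     decide = (\<lambda>K h. let s = width k (num_nodes K) in
       if length h = Suc k * Suc s then Some (seen_label k s K h) else None)\<rparr>"

lemma less_width_power:
  assumes "k \<ge> 1"
  shows "n < width k n ^ k"
proof -
  let ?x = "real n powr (1 / real k)"
  have "?x < real (width k n)"
    unfolding width_def by simp linarith
  then have "?x ^ k < real (width k n) ^ k"
    using assms by (intro power_strict_mono) auto
  moreover have "?x ^ k = real n"
  proof (cases "n = 0")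
    case True
    then show ?thesis using assms by simp
  next
    case False
    then show ?thesis using assms by (simp add: powr_powr flip: powr_realpow)
  qed
  ultimately show ?thesis by (metis of_nat_less_iff of_nat_power)
qed

text \<open>\<open>F\<close> is controlled only below \<open>M\<close>, because later messages carry
  colours; the first occurrence lies below \<open>M\<close>, so this is enough.\<close>

lemma Least_threshold:
  fixes a M :: nat
  assumes "\<And>t. t \<le> M \<Longrightarrow> (\<exists>r < t. F r) \<longleftrightarrow> a < t" and "a < M"
  shows "(LEAST r. F r) = a"
proof (rule Least_equality)
  have "\<not> (\<exists>r < a. F r)" "\<exists>r < Suc a. F r" using assms(1)[of a] assms(1)[of "Suc a"] assms(2) by auto
  then show "F a" by (metis less_Suc_eq)
  show "a \<le> r" if "F r" for r using \<open>\<not> (\<exists>r < a. F r)\<close> that by (meson not_less)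
qed

section \<open>The run of the algorithm on a network\<close>

locale peeling_run =
  fixes N :: network and c k n :: nat
  assumes net: "N \<in> networks c 2 n" and k_pos: "k \<ge> 1"
begin

abbreviation "s \<equiv> width k n"
abbreviation "K \<equiv> initial_knowledge N"
abbreviation "H \<equiv> history_of (peeling_algorithm k) N"

lemma card_verts: "card (verts N) = n"
  using net by (simp add: networks_def)

sublocale peeling N k s
proof
  show "is_full_tree 2 N" using net by (simp add: networks_def)
  show "s \<ge> 1" by (simp add: width_def)
  show "card (verts N) < s ^ k" using less_width_power[OF k_pos] by (simp add: card_verts)
qed (rule k_pos)

lemma num_nodes: "num_nodes (K v) = n"
  by (simp add: initial_knowledge_def card_verts)

lemma ports: "v \<in> verts N \<Longrightarrow> distinct (ports N v) \<and> set (ports N v) = neighbours N v"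
  using net by (simp add: networks_def)

lemma port_to: assumes "v \<in> verts N" and "w \<in> neighbours N v"
  shows "port_to N v w < length (ports N v) \<and> ports N v ! port_to N v w = w"
proof -
  obtain i where i: "i < length (ports N v)" "ports N v ! i = w"
    using ports[OF assms(1)] assms(2) by (metis in_set_conv_nth)
  then have "\<exists>!i. i < length (ports N v) \<and> ports N v ! i = w"
    using ports[OF assms(1)] by (auto simp: nth_eq_iff_index_eq)
  then show ?thesis unfolding port_to_def by (rule theI')
qed

lemma parent_not_child: "v \<in> verts N \<Longrightarrow> parent N v = Some u \<Longrightarrow> u \<notin> children N v"
proof
  assume v: "v \<in> verts N" "parent N v = Some u" and "u \<in> children N v"
  then have u: "u \<in> verts N" "parent N u = Some v" by (auto simp: children_def)
  obtain d :: "nat \<Rightarrow> nat" where "\<forall>v \<in> verts N. \<forall>u. parent N v = Some u \<longrightarrow> d u < d v"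
    using rooted_tree_depth[OF tree] by blast
  then have "d u < d v" "d v < d u" using u v by blast+
  then show False by simp
qed

lemma neighbour_other:
  assumes v: "v \<in> verts N" and w: "w \<in> neighbours N v"
  shows "w \<in> verts N \<and> w \<noteq> v"
proof
  show "w \<in> verts N" using w parent_in_verts[OF v] by (auto simp: neighbours_def children_def)
  show "w \<noteq> v"
  proof
    assume "w = v"
    then have "parent N v = Some v" using w by (auto simp: neighbours_def children_def)
    moreover from this have "v \<in> children N v" using v by (simp add: children_def)
    ultimately show False using parent_not_child[OF v] by blast
  qed
qed

lemma child_ports: assumes v: "v \<in> verts N"
  shows "(!) (ports N v) ` child_ports (K v) = children N v"
proof (intro equalityI subsetI)
  fix w assume "w \<in> (!) (ports N v) ` child_ports (K v)"
  then obtain i where i: "w = ports N v ! i" "i < length (ports N v)"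
    "map_option (port_to N v) (parent N v) \<noteq> Some i"
    by (auto simp: child_ports_def initial_knowledge_def)
  then have "w \<in> neighbours N v" using ports[OF v] nth_mem by metis
  moreover have "parent N v \<noteq> Some w"
  proof
    assume p: "parent N v = Some w"
    then have "port_to N v w < length (ports N v)" "ports N v ! port_to N v w = w"
      using port_to[OF v] by (auto simp: neighbours_def)
    then have "port_to N v w = i" using i ports[OF v] by (simp add: nth_eq_iff_index_eq)
    then show False using i p by simp
  qed
  ultimately show "w \<in> children N v" by (auto simp: neighbours_def)
next
  fix w assume w: "w \<in> children N v"
  then have "w \<in> neighbours N v" by (simp add: neighbours_def)
  then have i: "port_to N v w < length (ports N v)" "ports N v ! port_to N v w = w"
    using port_to[OF v] by auto
  have "map_option (port_to N v) (parent N v) \<noteq> Some (port_to N v w)"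
  proof
    assume "map_option (port_to N v) (parent N v) = Some (port_to N v w)"
    then obtain u where u: "parent N v = Some u" "port_to N v u = port_to N v w" by auto
    then have "ports N v ! port_to N v u = u" using port_to[OF v, of u] by (simp add: neighbours_def)
    then have "u = w" using u(2) i(2) by simp
    then show False using parent_not_child[OF v u(1)] w by simp
  qed
  then show "w \<in> (!) (ports N v) ` child_ports (K v)"
    using i by (intro image_eqI[of _ _ "port_to N v w"]) (auto simp: child_ports_def initial_knowledge_def)
qed

definition sent :: "nat \<Rightarrow> nat \<Rightarrow> bool" where
  "sent t v = bit k s (K v) (H t v)"

lemma length_H: "length (H t v) = t"
  by (induction t) auto

lemma H_Suc: "H (Suc t) v = H t v @ [map (\<lambda>w. [sent t w]) (ports N v)]"
  by (simp add: peeling_algorithm_def sent_def num_nodes)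

lemma H_nth: "r < t \<Longrightarrow> H t v ! r = map (\<lambda>w. [sent r w]) (ports N v)"
proof (induction t)
  case (Suc t)
  then show ?case unfolding H_Suc by (auto simp: nth_append length_H less_Suc_eq)
qed simp

lemma parent_port:
  assumes v: "v \<in> verts N" and u: "parent N v = Some u"
  shows "parent_port (K v) = Some (port_to N v u)"
    and "r < t \<Longrightarrow> H t v ! r ! port_to N v u = [sent r u]"
  using u port_to[OF v, of u] by (auto simp: initial_knowledge_def H_nth neighbours_def)

lemma fires_iff:
  assumes v: "v \<in> verts N" and r: "r < t"
  shows "fires s (K v) r (H t v ! r) \<longleftrightarrow>
    (if Suc s dvd Suc r then \<exists>w \<in> children N v. sent r w else \<forall>w \<in> children N v. sent r w)"
proof -
  have "H t v ! r ! i = [True] \<longleftrightarrow> sent r (ports N v ! i)" if "i \<in> child_ports (K v)" for i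
    using that r by (simp add: H_nth child_ports_def initial_knowledge_def)
  then show ?thesis unfolding fires_def child_ports[OF v, symmetric] by auto
qed

text \<open>During the peeling rounds each bit received in round \<open>r\<close> is the sender's
  own verdict on \<open>peeled r\<close>, correct by induction, so the vertex evaluates the true
  peeling rule.\<close>

lemma seen_peeled_iff:
  "r \<le> k * Suc s \<Longrightarrow> v \<in> verts N \<Longrightarrow> r \<le> t \<Longrightarrow> seen_peeled s (K v) (H t v) r \<longleftrightarrow> v \<in> peeled r"
proof (induction r arbitrary: v t)
  case (Suc r)
  have "sent r w \<longleftrightarrow> w \<in> peeled r" if "w \<in> verts N" for w
    using Suc.IH[of w r] Suc.prems(1) that by (simp add: sent_def bit_def length_H)
  then have "sent r w \<longleftrightarrow> w \<in> peeled r" if "w \<in> children N v" for w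
    using that children_subset by blast
  then have "fires s (K v) r (H t v ! r) \<longleftrightarrow> (if Suc s dvd Suc r
      then \<exists>w \<in> children N v. w \<in> peeled r else \<forall>w \<in> children N v. w \<in> peeled r)"
    using fires_iff[OF Suc.prems(2), of r t] Suc.prems(3) by auto
  moreover have "seen_peeled s (K v) (H t v) (Suc r) \<longleftrightarrow>
      seen_peeled s (K v) (H t v) r \<or> fires s (K v) r (H t v ! r)"
    by (auto simp: seen_peeled_def less_Suc_eq)
  moreover have "seen_peeled s (K v) (H t v) r \<longleftrightarrow> v \<in> peeled r" using Suc by simp
  ultimately show ?case using Suc.prems(2) by simp
qed (simp add: seen_peeled_def)

lemma sent_peeled: "r < k * Suc s \<Longrightarrow> v \<in> verts N \<Longrightarrow> sent r v \<longleftrightarrow> v \<in> peeled r"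
  using seen_peeled_iff[of r v r] by (simp add: sent_def bit_def length_H)

lemma all_rounds: "(k - 1) * Suc s + s < k * Suc s"
  using k_pos by (cases k) auto

lemma seen_round_eq:
  assumes v: "v \<in> verts N" and t: "k * Suc s \<le> t"
  shows "seen_round s (K v) (H t v) = round_of v"
  unfolding seen_round_def
proof (rule Least_threshold)
  show "(\<exists>r < t'. fires s (K v) r (H t v ! r)) \<longleftrightarrow> round_of v < t'" if "t' \<le> k * Suc s" for t'
    using seen_peeled_iff[OF that v, of t] that t peeled_iff[OF v] by (simp add: seen_peeled_def)
  show "round_of v < k * Suc s" using round_bound[OF v] all_rounds by (rule less_trans)
qed

lemma seen_linked_iff:
  assumes v: "v \<in> verts N" and t: "k * Suc s \<le> t"
  shows "seen_linked s (K v) (H t v) \<longleftrightarrow> linked v"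
proof (cases "parent N v")
  case None
  then show ?thesis by (simp add: seen_linked_def linked_def initial_knowledge_def)
next
  case (Some u)
  \<comment> \<open>Both history entries that \<open>seen_linked\<close> inspects date from before
    the colouring, so they report peeling.\<close>
  have "Suc (phase v) * Suc s \<le> k * Suc s" using phase_less(1)[OF v] by (intro mult_le_mono1) simp
  then have b: "phase v * Suc s + s < k * Suc s" by simp
  have u: "u \<in> verts N" using parent_in_verts v Some by blast
  have seen: "H t v ! r ! port_to N v u = [True] \<longleftrightarrow> u \<in> peeled r" if "r < k * Suc s" for r
    using parent_port(2)[OF v Some, of r t] sent_peeled[OF that u] that t by simp
  have "H t v ! (phase v * Suc s) ! port_to N v u = [True] \<longleftrightarrow> u \<in> peeled (phase v * Suc s)"
    "H t v ! (phase v * Suc s + s) ! port_to N v u = [True] \<longleftrightarrow> u \<in> peeled (phase v * Suc s + s)"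
    using seen[OF le_less_trans[OF le_add1 b]] seen[OF b] .
  then show ?thesis
    unfolding seen_linked_def linked_def seen_round_eq[OF v t] phase_def[symmetric] Let_def
      parent_port(1)[OF v Some] Some by auto
qed

lemma seen_colour_iff:
  "v \<in> verts N \<Longrightarrow> seen_colour k s (K v) (H (k * Suc s + j) v) \<longleftrightarrow> colour j v"
proof (induction j arbitrary: v)
  case 0
  then show ?case by (simp add: seen_colour_def length_H)
next
  case (Suc j)
  let ?t = "k * Suc s + j"
  show ?case
  proof (cases "linked v")
    case True
    then obtain u where u: "parent N v = Some u" by (auto simp: linked_def)
    have uV: "u \<in> verts N" using parent_in_verts Suc.prems u by blast
    have "last (H (Suc ?t) v) ! port_to N v u = H (Suc ?t) v ! ?t ! port_to N v u"
      by (subst last_conv_nth) (auto simp: length_H simp flip: length_greater_0_conv simp del: history_of.simps)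
    also have "\<dots> = [sent ?t u]" by (rule parent_port(2)[OF Suc.prems u]) simp
    also have "sent ?t u = colour j u"
      using Suc.IH[OF uV] by (simp add: sent_def bit_def length_H)
    finally have "last (H (Suc ?t) v) ! port_to N v u = [colour j u]" .
    then show ?thesis
      using True u seen_linked_iff[OF Suc.prems, of "Suc ?t"] parent_port(1)[OF Suc.prems u]
      by (simp add: seen_colour_def length_H del: history_of.simps mult_Suc_right)
  next
    case False
    then show ?thesis
      using seen_linked_iff[OF Suc.prems, of "Suc ?t"]
      by (simp add: seen_colour_def length_H del: history_of.simps mult_Suc_right)
  qed
qed

lemma seen_label_eq:
  assumes v: "v \<in> verts N"
  shows "seen_label k s (K v) (H (Suc k * Suc s) v) = final_label v"
proof -
  have T: "Suc k * Suc s = k * Suc s + Suc s" by simp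
  have "seen_colour k s (K v) (H (Suc k * Suc s) v) \<longleftrightarrow> colour (Suc s) v"
    unfolding T by (rule seen_colour_iff[OF v])
  moreover have "seen_round s (K v) (H (Suc k * Suc s) v) = round_of v"
    by (rule seen_round_eq[OF v]) simp
  ultimately show ?thesis
    by (simp only: seen_label_def final_label_def Let_def cut_def phase_def)
qed

lemma decision_eq:
  "v \<in> verts N \<Longrightarrow> decision (peeling_algorithm k) N t v =
    (if t = Suc k * Suc s then Some (final_label v) else None)"
  using seen_label_eq[of v] length_H[of t v]
  by (simp add: decision_def Let_def num_nodes peeling_algorithm_def[THEN arg_cong[where f = decide]]
      del: mult_Suc mult_Suc_right)

lemma output_eq:
  assumes v: "v \<in> verts N"
  shows "output_label (peeling_algorithm k) N v = final_label v"
proof -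
  have "(LEAST t. decision (peeling_algorithm k) N t v \<noteq> None) = Suc k * Suc s"
    by (rule Least_equality) (auto simp: decision_eq[OF v] split: if_splits)
  then show ?thesis by (simp add: output_label_def decision_eq[OF v])
qed

lemma run_time: "running_time (peeling_algorithm k) N \<le> enat (Suc k * Suc s)"
  unfolding running_time_def by (rule Inf_lower) (auto simp: decision_eq intro!: exI[of _ "Suc k * Suc s"])

end

lemma peeling_algorithm_correct:
  assumes k: "k \<ge> 1" and "\<beta> \<ge> 1"
  shows "solves c (Pi_k k) (peeling_algorithm k)"
    and "respects_bandwidth \<beta> c (Pi_k k) (peeling_algorithm k)"
    and "worst_case_time c (Pi_k k) (peeling_algorithm k) n \<le> enat (Suc k * Suc (width k n))"
proof -
  have ar: "arity (Pi_k k) = 2" by (simp add: Pi_k_def)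
  have run: "peeling_run N c k n" if "N \<in> networks c 2 n" for N n
    using that k by unfold_locales
  show "solves c (Pi_k k) (peeling_algorithm k)"
    unfolding solves_def ar
  proof (intro allI ballI conjI)
    fix n N assume N: "N \<in> networks c 2 n"
    interpret peeling_run N c k n by (rule run[OF N])
    show "\<exists>t. decision (peeling_algorithm k) N t v \<noteq> None" if "v \<in> verts N" for v
      using decision_eq[OF that] by auto
    show "is_solution (Pi_k k) N (output_label (peeling_algorithm k) N)"
      by (rule final_label_solution) (rule output_eq)
  qed
  show "worst_case_time c (Pi_k k) (peeling_algorithm k) n \<le> enat (Suc k * Suc (width k n))"
    unfolding worst_case_time_def ar
    by (rule SUP_least) (rule peeling_run.run_time[OF run])
  \<comment> \<open>For \<open>n = 1\<close> the bandwidth is 0, but then there are no ports. A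
    vertex with a port has a neighbour, so \<open>n\<close> is at least 2 and one bit fits.\<close>
  have "1 \<le> \<beta> * nat \<lceil>log 2 (real n)\<rceil>"
    if N: "N \<in> networks c 2 n" and v: "v \<in> verts N" and i: "i < length (ports N v)" for n N v i
  proof -
    interpret peeling_run N c k n by (rule run[OF N])
    have "ports N v ! i \<in> neighbours N v" using ports[OF v] i nth_mem by metis
    then obtain w where "w \<in> verts N" "w \<noteq> v" using neighbour_other[OF v] by blast
    then have "card {v, w} \<le> card (verts N)" using v fin by (intro card_mono) auto
    then have "2 \<le> n" using \<open>w \<noteq> v\<close> by (simp add: card_verts)
    then have "0 < log 2 (real n)" by simp
    then have "1 \<le> nat \<lceil>log 2 (real n)\<rceil>" by linarith
    then show ?thesis using \<open>\<beta> \<ge> 1\<close> by (metis mult_le_mono nat_mult_1)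
  qed
  then show "respects_bandwidth \<beta> c (Pi_k k) (peeling_algorithm k)"
    unfolding respects_bandwidth_def ar by (simp add: peeling_algorithm_def)
qed

section \<open>Asymptotics\<close>

text \<open>CONGEST takes the infimum over fewer algorithms, so it suffices to have the upper bound
  in CONGEST and the lower bound in LOCAL.\<close>

lemma complexity_bounds:
  assumes k: "k \<ge> 1" and c: "c \<ge> 1" and \<beta>: "\<beta> \<ge> 1"
    and C: "C = local_complexity c (Pi_k k) \<or> C = congest_complexity \<beta> c (Pi_k k)"
  shows "C n \<le> enat (Suc k * Suc (width k n))"
    and "odd n \<Longrightarrow> C n = enat t \<Longrightarrow> n < (2 * (3 * t + 8 + k) + 1) ^ k"
proof -
  have "local_complexity c (Pi_k k) n \<le> congest_complexity \<beta> c (Pi_k k) n"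
    unfolding local_complexity_def congest_complexity_def by (rule INF_superset_mono) auto
  moreover have "congest_complexity \<beta> c (Pi_k k) n \<le> enat (Suc k * Suc (width k n))"
    unfolding congest_complexity_def
    by (rule INF_lower2[of "peeling_algorithm k"]) (use peeling_algorithm_correct[OF k \<beta>] in auto)
  ultimately show "C n \<le> enat (Suc k * Suc (width k n))" using C by auto
  assume n: "odd n" and t: "C n = enat t"
  then have "local_complexity c (Pi_k k) n < enat (Suc t)"
    using C \<open>local_complexity c (Pi_k k) n \<le> _\<close> by (auto intro: le_less_trans)
  then obtain A where "solves c (Pi_k k) A" "worst_case_time c (Pi_k k) A n < enat (Suc t)"
    unfolding local_complexity_def INF_less_iff by auto
  moreover from this(2) have "worst_case_time c (Pi_k k) A n \<le> enat t"
    by (cases "worst_case_time c (Pi_k k) A n") auto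
  ultimately show "n < (2 * (3 * t + 8 + k) + 1) ^ k"
    using local_lower_bound[OF _ k c n] by blast
qed

lemma has_order_complexity:
  assumes k: "k \<ge> 1" and c: "c \<ge> 1" and \<beta>: "\<beta> \<ge> 1"
    and C: "C = local_complexity c (Pi_k k) \<or> C = congest_complexity \<beta> c (Pi_k k)"
  shows "has_order C (\<lambda>n. real n powr (1 / real k)) odd_at_top"
proof -
  let ?x = "\<lambda>n :: nat. real n powr (1 / real k)"
  \<comment> \<open>The constant term of \<open>2 * (3 * t + 8 + k) + 1\<close>, which is
    \<open>6 * t + M\<close>.\<close>
  define M where "M = 2 * (8 + real k) + 1"
  have fin: "C n \<noteq> \<infinity>" for n
    using complexity_bounds(1)[OF assms, of n] by (cases "C n") auto
  have upper: "real (the_enat (C n)) \<le> 3 * (real k + 1) * ?x n" if "n \<ge> 1" for n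
  proof -
    obtain t where t: "C n = enat t" using fin[of n] by auto
    then have "t \<le> Suc k * Suc (width k n)" using complexity_bounds(1)[OF assms, of n] by simp
    then have "real t \<le> real (Suc k * Suc (width k n))" by linarith
    also have "\<dots> = (real k + 1) * (real (width k n) + 1)" by (simp add: algebra_simps)
    also have "\<dots> \<le> (real k + 1) * (3 * ?x n)"
    proof (rule mult_left_mono)
      \<comment> \<open>The root is at least 1 and absorbs both additive constants, from the
        rounding and from the extra round per phase.\<close>
      have "1 \<le> ?x n" using that by (simp add: ge_one_powr_ge_zero)
      moreover have "real (width k n) \<le> ?x n + 1" by (simp add: width_def)
      ultimately show "real (width k n) + 1 \<le> 3 * ?x n" by linarith
    qed simp
    finally show ?thesis using t by (simp add: algebra_simps)
  qed
  have lower: "?x n \<le> 12 * real (the_enat (C n))" if "odd n" "2 * M \<le> ?x n" for n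
  proof -
    obtain t where t: "C n = enat t" using fin[of n] by auto
    have "real n < real (2 * (3 * t + 8 + k) + 1) ^ k"
      using complexity_bounds(2)[OF assms that(1) t] by (metis of_nat_less_iff of_nat_power)
    then have "?x n \<le> (real (2 * (3 * t + 8 + k) + 1) ^ k) powr (1 / real k)"
      by (intro powr_mono2) auto
    also have "\<dots> = real (2 * (3 * t + 8 + k) + 1)"
      using k by (simp add: powr_powr flip: powr_realpow)
    finally have "?x n \<le> 6 * real t + M" by (simp add: M_def)
    \<comment> \<open>For large \<open>n\<close> the term \<open>M\<close> is at most half of the
      root, which doubles the factor 6 to 12.\<close>
    then show ?thesis using that(2) t by simp
  qed
  have "2 * M \<le> ?x n" if "nat \<lceil>(2 * M) ^ k\<rceil> \<le> n" for n
  proof -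
    define Y where "Y = 2 * M"
    have Y: "0 < Y" by (simp add: Y_def M_def add_pos_nonneg)
    have "Y ^ k \<le> real n" using that unfolding Y_def by linarith
    then have "(Y ^ k) powr (1 / real k) \<le> ?x n" using Y by (intro powr_mono2) auto
    then have "Y \<le> ?x n" using k Y by (simp add: powr_powr flip: powr_realpow)
    then show ?thesis by (simp add: Y_def)
  qed
  then have large: "eventually (\<lambda>n. 2 * M \<le> ?x n) at_top"
    by (rule eventually_at_top_linorderI)
  have "eventually (\<lambda>n. norm (real (the_enat (C n))) \<le> 3 * (real k + 1) * norm (?x n)) odd_at_top"
    unfolding odd_at_top_def eventually_inf_principal
    by (rule eventually_mono[OF eventually_ge_at_top[of 1]]) (use upper in simp)
  moreover have "eventually (\<lambda>n. norm (?x n) \<le> 12 * norm (real (the_enat (C n)))) odd_at_top"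
    unfolding odd_at_top_def eventually_inf_principal
    by (rule eventually_mono[OF large]) (use lower in simp)
  ultimately have "(\<lambda>n. real (the_enat (C n))) \<in> \<Theta>[odd_at_top](?x)"
    by (intro bigthetaI landau_o.bigI landau_omega.bigI[of "1 / 12"]) (auto elim: eventually_mono)
  then show ?thesis using fin by (simp add: has_order_def)
qed

theorem theorem8p3:
  fixes k c \<beta> :: nat
  assumes "k \<ge> 1" and "c \<ge> 1" and "\<beta> \<ge> 1"
  shows "has_order (local_complexity c (Pi_k k)) (\<lambda>n. real n powr (1 / real k)) odd_at_top \<and>
         has_order (congest_complexity \<beta> c (Pi_k k)) (\<lambda>n. real n powr (1 / real k)) odd_at_top"
  using has_order_complexity[OF assms] by blast

end
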